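(* Let $\mathbb{k}$ be a field, $S=\mathbb{k}[x_1,\ldots,x_n]$, $$I=\prod_{1\le i_1<\cdots<i_{n-1}\le n}(x_{i_1},\ldots,x_{i_{n-1}})\subset S,$$ and for an integer $k\ge1$ let $\beta_i^{(k)}=\beta_i(S/I^k)$. Then $$\beta_1^{(k)}=\binom{n(k+1)-1}{n-1}-n\binom{n+k-2}{n-1},$$ and $$\begin{bmatrix}\beta_2^{(k)}\\ \vdots\\ \beta_n^{(k)}\end{bmatrix}=\left[\binom{j}{i}\right]_{\substack{0\le i\le n-2\\ 0\le j\le n-2}}\left[\beta_1^{(k)}-\binom{nk+i}{i}\right]_{0\le i\le n-2}.$$
   Context: The ideal $I$ is the product of all $n$ ideals generated by $n-1$ of the $n$ variables (the ideal generated by the empty set is the zero ideal). For a homogeneous ideal $J\subset S$ (standard grading), the Betti numbers $\beta_i(S/J)$ are the ranks of the free modules in a minimal graded free resolution $0\to S^{\beta_n}\to\cdots\to S^{\beta_1}\to S\to S/J\to 0$. Convention: $\binom{j}{i}=0$ when $i>j$. $[c_{ij}]$ denotes the matrix with entry $c_{ij}$ in row $i$, column $j$, and $[c_i]$ denotes a column vector. *)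

theory Defs
  imports
    "HOL-Library.Poly_Mapping"
    "HOL-Library.Cardinality"
    "Jordan_Normal_Form.Matrix_Kernel"
begin

text \<open>
  The ring \<open>S\<close> of polynomials over \<open>'k\<close> in variables indexed by the finite type \<open>'n\<close>, so that the
  number of variables is \<open>CARD('n)\<close>: an element maps each exponent vector to its coefficient, and
  multiplication is the convolution product.
\<close>

type_synonym ('n, 'k) mpoly = "('n \<Rightarrow>\<^sub>0 nat) \<Rightarrow>\<^sub>0 'k"

definition var :: "'n \<Rightarrow> ('n, 'k::comm_ring_1) mpoly" where
  "var i = Poly_Mapping.single (Poly_Mapping.single i 1) 1"

definition mon_deg :: "('n::finite \<Rightarrow>\<^sub>0 nat) \<Rightarrow> nat" where
  "mon_deg m = (\<Sum>i\<in>UNIV. Poly_Mapping.lookup m i)"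

text \<open>In the standard grading; the zero polynomial is homogeneous of every degree, including the
  negative ones.\<close>

definition homogeneous :: "int \<Rightarrow> ('n::finite, 'k::comm_ring_1) mpoly \<Rightarrow> bool" where
  "homogeneous d p \<longleftrightarrow> (\<forall>m \<in> Poly_Mapping.keys p. int (mon_deg m) = d)"

text \<open>Ideals are the submodules of the ring as a module over itself; \<open>ideal.span B\<close> is the
  ideal generated by \<open>B\<close>.\<close>

global_interpretation ideal: module "(*) :: 'a::comm_ring_1 \<Rightarrow> 'a \<Rightarrow> 'a"
  by unfold_locales (simp_all add: algebra_simps)

definition ideal_prod :: "'b set \<Rightarrow> ('b \<Rightarrow> 'a::comm_ring_1 set) \<Rightarrow> 'a set" where
  "ideal_prod X J = ideal.span {\<Prod>x\<in>X. f x | f. \<forall>x\<in>X. f x \<in> J x}"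

definition ideal_power :: "'a::comm_ring_1 set \<Rightarrow> nat \<Rightarrow> 'a set" where
  "ideal_power J k = ideal_prod {..<k} (\<lambda>_. J)"

definition codim_one_ideal :: "('n::finite, 'k::field) mpoly set" where
  "codim_one_ideal =
     ideal_prod {X :: 'n set. card X = CARD('n) - 1} (\<lambda>X. ideal.span (var ` X))"

text \<open>
  A minimal graded free resolution \<open>0 \<rightarrow> F\<^sub>n \<rightarrow> \<dots> \<rightarrow> F\<^sub>1 \<rightarrow> S \<rightarrow> S/J \<rightarrow> 0\<close> with
  \<open>F\<^sub>i = S(- D i 0) \<oplus> \<dots> \<oplus> S(- D i (b i - 1))\<close>, whose differentials \<open>F\<^sub>i \<rightarrow> F\<^bsub>i-1\<^esub>\<close> are given by
  the matrices \<open>A i\<close>. The third to last condition is exactness at \<open>F\<^sub>0 = S\<close>, the next one is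
  exactness at \<open>F\<^sub>i\<close> for \<open>i \<ge> 1\<close>, and the last one is minimality: the differentials map \<open>F\<^sub>i\<close> into
  \<open>(x\<^sub>1, \<dots>, x\<^sub>n) F\<^bsub>i-1\<^esub>\<close>. As \<open>F\<^sub>0 = S\<close> is fixed, only proper ideals \<open>J\<close> have such a resolution.
\<close>

definition minimal_graded_resolution ::
  "('n::finite, 'k::field) mpoly set \<Rightarrow> (nat \<Rightarrow> nat) \<Rightarrow> (nat \<Rightarrow> nat \<Rightarrow> int) \<Rightarrow>
     (nat \<Rightarrow> ('n, 'k) mpoly mat) \<Rightarrow> bool" where
  "minimal_graded_resolution J b D A \<longleftrightarrow>
     b 0 = 1 \<and> D 0 0 = 0 \<and>
     (\<forall>i > CARD('n). b i = 0) \<and>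
     (\<forall>i \<ge> 1. A i \<in> carrier_mat (b (i - 1)) (b i)) \<and>
     (\<forall>i \<ge> 1. \<forall>r < b (i - 1). \<forall>c < b i. homogeneous (D i c - D (i - 1) r) (A i $$ (r, c))) \<and>
     {(A 1 *\<^sub>v v) $ 0 | v. v \<in> carrier_vec (b 1)} = J \<and>
     (\<forall>i \<ge> 1. mat_kernel (A i) = {A (i + 1) *\<^sub>v w | w. w \<in> carrier_vec (b (i + 1))}) \<and>
     (\<forall>i \<ge> 1. \<forall>r < b (i - 1). \<forall>c < b i. A i $$ (r, c) \<in> ideal.span (range var))"

text \<open>The Betti number \<open>\<beta>\<^sub>i(S/J)\<close>, for \<open>J\<close> a proper homogeneous ideal.\<close>

definition betti :: "('n::finite, 'k::field) mpoly set \<Rightarrow> nat \<Rightarrow> nat" where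
  "betti J i = (THE r. \<exists>b D A. minimal_graded_resolution J b D A \<and> b i = r)"

end

theory Submission
  imports Defs
begin

text \<open>
  The power \<open>I\<^sup>k\<close> is generated by the monomials of degree \<open>n k\<close> all of whose exponents are at most
  \<open>a = (n - 1) k\<close>. Adding these generators in decreasing lexicographic order, each successive colon
  ideal is generated by variables: \<open>x\<^sub>i\<close> occurs in the colon ideal of \<open>u\<close> iff \<open>u\<^sub>i < a\<close> and some later
  variable divides \<open>u\<close>. Iterated mapping cones with Koszul complexes therefore give a linear, hence
  minimal, resolution of rank \<open>\<Sum>\<^sub>u (t u choose (i - 1))\<close> in position \<open>i\<close>, where \<open>t u\<close> is the number of
  variables in the colon ideal of \<open>u\<close>, and any two minimal resolutions have the same ranks. Finally,
  \<open>t u \<le> j\<close> holds for exactly as many \<open>u\<close> as there are monomials of degree \<open>n k\<close> in \<open>j + 1\<close>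
  variables: moving the excess of an exponent over \<open>a\<close> to the next variable gives a bijection.
\<close>

section \<open>Ranks of minimal resolutions\<close>

text \<open>\<open>betti\<close> picks out a unique value, so every minimal resolution has to be
  compared with the constructed one. Two minimal resolutions admit comparison maps in both
  directions that are inverse up to homotopy; modulo the variables the homotopy vanishes, and a
  product of matrices over the field equal to 1 remains. The cap (n - 1) k counts those among the n
  k factors of I^k that contain a given variable. For n at least 2 it satisfies n k \<le> 2 (n - 1)
  k, and this inequality drives both counts. Two exponents cannot both exceed the cap, so
  inclusion-exclusion for the generators stops after the single violations; this gives the first
  Betti number. Two exponents at the cap leave no degree for a third variable, so the colon ideal of
  u contains all variables before the last one in u, with at most one exception; this controls t u.
  Finally, for i at least 2, the hockey-stick identity expands \<open>t u choose (i - 1)\<close> as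
  a sum over j < t u, and exchanging sums yields the binomial matrix applied to the numbers of u
  with t u > j. For n = 1 there are no generators and the matrix is empty.\<close>

lemma mult_unit_vec_col:
  fixes A :: "'a::comm_ring_1 mat"
  assumes "A \<in> carrier_mat nr nc" "j < nc"
  shows "A *\<^sub>v unit_vec nc j = col A j"
proof (rule eq_vecI)
  fix i assume "i < dim_vec (col A j)"
  then show "(A *\<^sub>v unit_vec nc j) $ i = col A j $ i"
    using assms scalar_prod_right_unit[of j nc "row A i"] by auto
qed (use assms in auto)

lemma mat_eq_zero_if_mult_vec_eq_zero:
  fixes A :: "'a::comm_ring_1 mat"
  assumes A: "A \<in> carrier_mat nr nc"
    and z: "\<And>v. v \<in> carrier_vec nc \<Longrightarrow> A *\<^sub>v v = 0\<^sub>v nr"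
  shows "A = 0\<^sub>m nr nc"
proof (rule mat_col_eqI)
  fix j assume "j < dim_col (0\<^sub>m nr nc :: 'a mat)"
  then have j: "j < nc" by simp
  show "col A j = col (0\<^sub>m nr nc) j"
    using mult_unit_vec_col[OF A j] z[of "unit_vec nc j"] j by simp
qed (use A in auto)

lemma solve_mat_columnwise:
  fixes N :: "'a::comm_ring_1 mat"
  assumes N: "N \<in> carrier_mat r n" and M: "M \<in> carrier_mat r c"
    and ex: "\<And>j. j < c \<Longrightarrow> \<exists>v\<in>carrier_vec n. N *\<^sub>v v = col M j"
  shows "\<exists>X\<in>carrier_mat n c. N * X = M"
proof -
  obtain f where f: "\<And>j. j < c \<Longrightarrow> f j \<in> carrier_vec n" "\<And>j. j < c \<Longrightarrow> N *\<^sub>v f j = col M j"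
    using ex by metis
  define X where "X = mat_of_cols n (map f [0..<c])"
  have X: "X \<in> carrier_mat n c" by (simp add: X_def mat_of_cols_carrier(1)[of n "map f [0..<c]", simplified])
  have "N * X = M"
  proof (rule mat_col_eqI)
    fix j assume "j < dim_col M"
    then have j: "j < c" using M by simp
    have "col X j = f j" unfolding X_def using j f by (subst col_mat_of_cols) auto
    then show "col (N * X) j = col M j" using col_mult2[OF N X j] f j by simp
  qed (use N M X in auto)
  then show ?thesis using X by blast
qed

section \<open>Comparison of free resolutions\<close>

lemma comp_eq_zero_if_exact:
  fixes A :: "'a::comm_ring_1 mat"
  assumes A: "A \<in> carrier_mat a b" and B: "B \<in> carrier_mat b c"
    and ex: "mat_kernel A = {B *\<^sub>v w | w. w \<in> carrier_vec c}"
  shows "A * B = 0\<^sub>m a c"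
proof (rule mat_eq_zero_if_mult_vec_eq_zero)
  fix v :: "'a vec" assume v: "v \<in> carrier_vec c"
  have "B *\<^sub>v v \<in> mat_kernel A" using ex v by auto
  then show "A * B *\<^sub>v v = 0\<^sub>v a" using v A B mat_kernelD[OF A] by simp
qed (use A B in auto)

text \<open>Projectivity of a free module in matrix form: each column of \<open>M\<close> is a
  cycle, hence a boundary.\<close>

lemma factor_through_exact:
  fixes A :: "'a::comm_ring_1 mat"
  assumes A: "A \<in> carrier_mat a b" and B: "B \<in> carrier_mat b c" and M: "M \<in> carrier_mat b m"
    and ex: "mat_kernel A = {B *\<^sub>v w | w. w \<in> carrier_vec c}"
    and AM: "A * M = 0\<^sub>m a m"
  shows "\<exists>X\<in>carrier_mat c m. B * X = M"
proof (rule solve_mat_columnwise[OF B M])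
  fix j assume j: "j < m"
  have "A *\<^sub>v col M j = 0\<^sub>v a" using col_mult2[OF A M j] AM j by simp
  then have "col M j \<in> mat_kernel A" using mat_kernelI[OF A] M by auto
  then show "\<exists>v\<in>carrier_vec c. B *\<^sub>v v = col M j" unfolding ex by auto
qed

text \<open>Exactness is imposed from position 1 on. The image of \<open>A 1\<close>, which
  determines the resolved module, is prescribed separately where it matters.\<close>

definition free_resolution :: "(nat \<Rightarrow> nat) \<Rightarrow> (nat \<Rightarrow> 'a::comm_ring_1 mat) \<Rightarrow> bool" where
  "free_resolution b A \<longleftrightarrow>
     (\<forall>i. A (Suc i) \<in> carrier_mat (b i) (b (Suc i))) \<and>
     (\<forall>i. mat_kernel (A (Suc i)) = {A (Suc (Suc i)) *\<^sub>v w | w. w \<in> carrier_vec (b (Suc (Suc i)))})"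

lemma free_resolution_carrier:
  "free_resolution b A \<Longrightarrow> A (Suc i) \<in> carrier_mat (b i) (b (Suc i))"
  by (simp add: free_resolution_def)

lemma free_resolution_exact:
  "free_resolution b A \<Longrightarrow>
     mat_kernel (A (Suc i)) = {A (Suc (Suc i)) *\<^sub>v w | w. w \<in> carrier_vec (b (Suc (Suc i)))}"
  by (simp add: free_resolution_def)

lemma free_resolution_comp:
  assumes "free_resolution b A"
  shows "A (Suc i) * A (Suc (Suc i)) = 0\<^sub>m (b i) (b (Suc (Suc i)))"
  by (rule comp_eq_zero_if_exact[OF free_resolution_carrier free_resolution_carrier free_resolution_exact])
    (rule assms)+

lemma free_resolution_factor:
  assumes "free_resolution b A" "M \<in> carrier_mat (b (Suc i)) m" "A (Suc i) * M = 0\<^sub>m (b i) m"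
  shows "\<exists>X\<in>carrier_mat (b (Suc (Suc i))) m. A (Suc (Suc i)) * X = M"
  by (rule factor_through_exact[OF free_resolution_carrier free_resolution_carrier _ free_resolution_exact])
    (rule assms)+

text \<open>The comparison theorem. Once \<open>f i\<close> and \<open>f (Suc i)\<close> commute
  with the differentials, \<open>f (Suc i) * A (Suc (Suc i))\<close> is killed by
  \<open>B (Suc i)\<close>, so it factors through the next differential of the exact target. The
  source is any complex, so that the lemma also applies to negated differentials.\<close>

lemma lift_chain_map:
  fixes A B :: "nat \<Rightarrow> 'a::comm_ring_1 mat"
  assumes cA: "\<And>i. A (Suc i) \<in> carrier_mat (a i) (a (Suc i))"
    and AA: "\<And>i. A (Suc i) * A (Suc (Suc i)) = 0\<^sub>m (a i) (a (Suc (Suc i)))"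
    and B: "free_resolution b B"
    and f0: "f0 \<in> carrier_mat (b 0) (a 0)"
    and im: "\<And>v. v \<in> carrier_vec (a 1) \<Longrightarrow> \<exists>w\<in>carrier_vec (b 1). B 1 *\<^sub>v w = f0 *\<^sub>v (A 1 *\<^sub>v v)"
  obtains f where "f 0 = f0" "\<And>i. f i \<in> carrier_mat (b i) (a i)"
    "\<And>i. B (Suc i) * f (Suc i) = f i * A (Suc i)"
proof -
  note cB = free_resolution_carrier[OF B]
  \<comment> \<open>The invariant contains solvability of the next equation; \<open>Q\<close>
    records that the next choice is such a solution. This is the form that dependent choice can
    iterate.\<close>
  define P where "P i X \<longleftrightarrow> X \<in> carrier_mat (b i) (a i) \<and> (i = 0 \<longrightarrow> X = f0) \<and>
     (\<exists>Y\<in>carrier_mat (b (Suc i)) (a (Suc i)). B (Suc i) * Y = X * A (Suc i))" for i X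
  define Q where "Q i X Y \<longleftrightarrow> B (Suc i) * Y = X * A (Suc i)" for i and X Y :: "'a mat"
  have P0: "P 0 f0"
  proof -
    have "\<exists>Y\<in>carrier_mat (b 1) (a 1). B 1 * Y = f0 * A 1"
    proof (rule solve_mat_columnwise)
      show "B 1 \<in> carrier_mat (b 0) (b 1)" using cB[of 0] by simp
      show "f0 * A 1 \<in> carrier_mat (b 0) (a 1)" using cA[of 0] f0 by simp
      fix j assume j: "j < a 1"
      have "col (f0 * A 1) j = f0 *\<^sub>v (A 1 *\<^sub>v unit_vec (a 1) j)"
        using mult_unit_vec_col[of "A 1"] col_mult2[OF f0, of "A 1"] cA[of 0] j by simp
      then show "\<exists>v\<in>carrier_vec (b 1). B 1 *\<^sub>v v = col (f0 * A 1) j"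
        using im[of "unit_vec (a 1) j"] by simp
    qed
    then show ?thesis using f0 by (simp add: P_def)
  qed
  have step: "\<exists>Y. P (Suc i) Y \<and> Q i X Y" if "P i X" for i X
  proof -
    from that obtain Y where X: "X \<in> carrier_mat (b i) (a i)"
      and Y: "Y \<in> carrier_mat (b (Suc i)) (a (Suc i))" "B (Suc i) * Y = X * A (Suc i)"
      by (auto simp: P_def)
    have "B (Suc i) * (Y * A (Suc (Suc i))) = (B (Suc i) * Y) * A (Suc (Suc i))"
      using assoc_mult_mat[OF cB Y(1) cA] by simp
    also have "\<dots> = X * (A (Suc i) * A (Suc (Suc i)))"
      unfolding Y(2) using assoc_mult_mat[OF X cA cA] by simp
    also have "\<dots> = 0\<^sub>m (b i) (a (Suc (Suc i)))" unfolding AA using X by simp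
    finally have "\<exists>Z\<in>carrier_mat (b (Suc (Suc i))) (a (Suc (Suc i))).
        B (Suc (Suc i)) * Z = Y * A (Suc (Suc i))"
      using free_resolution_factor[OF B] mult_carrier_mat[OF Y(1) cA] by blast
    then show ?thesis using Y by (auto simp: P_def Q_def)
  qed
  obtain f where f: "\<And>i. P i (f i)" "\<And>i. Q i (f i) (f (Suc i))"
    using dependent_nat_choice[of P Q] P0 step by metis
  have "f 0 = f0" using f(1)[of 0] by (simp add: P_def)
  then show ?thesis using that f by (simp add: P_def Q_def)
qed

text \<open>The zero matrix starts the induction because \<open>f 0 = 0\<close>. Afterwards the
  defect \<open>f (Suc i) - h i * A (Suc i)\<close> consists of cycles and is lifted through
  \<open>A (Suc (Suc i))\<close> to give \<open>h (Suc i)\<close>.\<close>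

lemma null_homotopy:
  fixes A :: "nat \<Rightarrow> 'a::comm_ring_1 mat"
  assumes A: "free_resolution b A"
    and c: "\<And>i. f i \<in> carrier_mat (b i) (b i)"
    and f0: "f 0 = 0\<^sub>m (b 0) (b 0)"
    and ch: "\<And>i. A (Suc i) * f (Suc i) = f i * A (Suc i)"
  obtains h where "\<And>i. h i \<in> carrier_mat (b (Suc i)) (b i)"
    "\<And>i. f (Suc i) = A (Suc (Suc i)) * h (Suc i) + h i * A (Suc i)"
proof -
  note cA = free_resolution_carrier[OF A]
  \<comment> \<open>The product in \<open>P\<close> equals
    \<open>A (Suc i) * (f (Suc i) - X * A (Suc i))\<close> by the chain map equation, so its
    vanishing says that the next defect is a cycle.\<close>
  define P where "P i X \<longleftrightarrow> X \<in> carrier_mat (b (Suc i)) (b i) \<and>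
     (f i - A (Suc i) * X) * A (Suc i) = 0\<^sub>m (b i) (b (Suc i))" for i X
  define Q where "Q i X Y \<longleftrightarrow> A (Suc (Suc i)) * Y = f (Suc i) - X * A (Suc i)" for i and X Y :: "'a mat"
  have "f 0 - A (Suc 0) * 0\<^sub>m (b (Suc 0)) (b 0) = 0\<^sub>m (b 0) (b 0)"
    unfolding f0 using cA[of 0] by (intro eq_matI) auto
  then have "P 0 (0\<^sub>m (b (Suc 0)) (b 0))" using cA[of 0] by (simp add: P_def)
  moreover have "\<exists>Y. P (Suc i) Y \<and> Q i X Y" if "P i X" for i X
  proof -
    from that have X: "X \<in> carrier_mat (b (Suc i)) (b i)"
      and z: "(f i - A (Suc i) * X) * A (Suc i) = 0\<^sub>m (b i) (b (Suc i))" by (auto simp: P_def)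
    have XA: "X * A (Suc i) \<in> carrier_mat (b (Suc i)) (b (Suc i))" using X cA[of i] by simp
    have AX: "A (Suc i) * X \<in> carrier_mat (b i) (b i)" using X cA[of i] by simp
    have "A (Suc i) * (f (Suc i) - X * A (Suc i)) = A (Suc i) * f (Suc i) - A (Suc i) * (X * A (Suc i))"
      using mult_minus_distrib_mat[OF cA c XA] by simp
    also have "\<dots> = f i * A (Suc i) - (A (Suc i) * X) * A (Suc i)"
      using assoc_mult_mat[OF cA X cA] ch by simp
    also have "\<dots> = (f i - A (Suc i) * X) * A (Suc i)"
      using minus_mult_distrib_mat[OF c AX cA] by simp
    finally obtain Y where Y: "Y \<in> carrier_mat (b (Suc (Suc i))) (b (Suc i))"
      "A (Suc (Suc i)) * Y = f (Suc i) - X * A (Suc i)"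
      using free_resolution_factor[OF A, of "f (Suc i) - X * A (Suc i)" i] z c[of "Suc i"] XA
      by (metis minus_carrier_mat)
    have "f (Suc i) - (f (Suc i) - X * A (Suc i)) = X * A (Suc i)"
      using c[of "Suc i"] XA by (intro eq_matI) auto
    then have "(f (Suc i) - A (Suc (Suc i)) * Y) * A (Suc (Suc i)) = X * (A (Suc i) * A (Suc (Suc i)))"
      unfolding Y(2) using assoc_mult_mat[OF X cA cA] by simp
    also have "\<dots> = 0\<^sub>m (b (Suc i)) (b (Suc (Suc i)))"
      unfolding free_resolution_comp[OF A] using X by simp
    finally show ?thesis using Y by (auto simp: P_def Q_def)
  qed
  ultimately obtain h where h: "\<And>i. P i (h i)" "\<And>i. Q i (h i) (h (Suc i))"
    using dependent_nat_choice[of P Q] by metis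
  have "f (Suc i) = A (Suc (Suc i)) * h (Suc i) + h i * A (Suc i)" for i
  proof -
    have "h i * A (Suc i) \<in> carrier_mat (b (Suc i)) (b (Suc i))" using h(1)[of i] cA[of i] by (auto simp: P_def)
    then have "f (Suc i) = (f (Suc i) - h i * A (Suc i)) + h i * A (Suc i)"
      using c[of "Suc i"] by (intro eq_matI) auto
    then show ?thesis using h(2)[of i] by (simp add: Q_def)
  qed
  moreover have "h i \<in> carrier_mat (b (Suc i)) (b i)" for i using h(1) by (simp add: P_def)
  ultimately show ?thesis using that by blast
qed

text \<open>If \<open>m < n\<close>, pad both factors with zeros to square matrices. The product
  stays 1, so the product in the other order is 1 as well, although row \<open>m\<close> of the
  padded \<open>F\<close> is zero.\<close>

lemma left_inverse_dim_le:
  fixes G :: "'a::field mat"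
  assumes G: "G \<in> carrier_mat n m" and F: "F \<in> carrier_mat m n" and GF: "G * F = 1\<^sub>m n"
  shows "n \<le> m"
proof (rule ccontr)
  assume "\<not> n \<le> m"
  then have mn: "m < n" by simp
  define G' where "G' = mat n n (\<lambda>(i, j). if j < m then G $$ (i, j) else 0)"
  define F' where "F' = mat n n (\<lambda>(i, j). if i < m then F $$ (i, j) else 0)"
  have c: "G' \<in> carrier_mat n n" "F' \<in> carrier_mat n n" by (auto simp: G'_def F'_def)
  have "G' * F' = G * F"
  proof (rule eq_matI)
    fix i j assume "i < dim_row (G * F)" "j < dim_col (G * F)"
    then have ij: "i < n" "j < n" using G F by auto
    have "(\<Sum>k = 0..<n. (if k < m then G $$ (i, k) else 0) * (if k < m then F $$ (k, j) else 0))
        = (\<Sum>k = 0..<m. G $$ (i, k) * F $$ (k, j))"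
      using mn by (intro sum.mono_neutral_cong_right) auto
    then show "(G' * F') $$ (i, j) = (G * F) $$ (i, j)"
      using ij G F by (simp add: G'_def F'_def scalar_prod_def)
  qed (use G F in \<open>auto simp: G'_def F'_def\<close>)
  then have "F' * G' = 1\<^sub>m n" using mat_mult_left_right_inverse[OF c] GF by simp
  then have "(F' * G') $$ (m, m) = 1" using mn by simp
  moreover have "(F' * G') $$ (m, m) = 0"
    using mn by (simp add: F'_def G'_def scalar_prod_def)
  ultimately show False by simp
qed

section \<open>Reduction modulo the variables\<close>

definition const_coeff :: "('n, 'k::comm_ring_1) mpoly \<Rightarrow> 'k" where
  "const_coeff p = Poly_Mapping.lookup p 0"

lemma add_eq_zero_iff_monomial:
  fixes k q :: "'n \<Rightarrow>\<^sub>0 nat"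
  shows "k + q = 0 \<longleftrightarrow> k = 0 \<and> q = 0"
  by (auto simp: poly_mapping_eq_iff lookup_add fun_eq_iff)

text \<open>Exponents are natural numbers, so 0 is a sum of two exponent vectors only as 0 + 0.
  Hence \<open>const_coeff\<close> is the residue map to the field in which minimality is
  tested.\<close>

lemma const_coeff_mult:
  fixes p q :: "('n, 'k::comm_ring_1) mpoly"
  shows "const_coeff (p * q) = const_coeff p * const_coeff q"
proof -
  have "prod_fun (Poly_Mapping.lookup p) (Poly_Mapping.lookup q) 0
      = (\<Sum>(a, b). Poly_Mapping.lookup p a * Poly_Mapping.lookup q b when 0 = a + b)"
    by (rule prod_fun_unfold_prod) auto
  also have "\<dots> = (\<Sum>ab. (Poly_Mapping.lookup p 0 * Poly_Mapping.lookup q 0) when ab = (0 :: 'n \<Rightarrow>\<^sub>0 nat, 0 :: 'n \<Rightarrow>\<^sub>0 nat))"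
    by (intro arg_cong[of _ _ Sum_any] ext) (auto simp: when_def add_eq_zero_iff_monomial eq_commute[of 0] split: if_splits)
  finally show ?thesis by (simp add: const_coeff_def times_poly_mapping.rep_eq)
qed

interpretation const_coeff: comm_ring_hom "const_coeff :: ('n, 'k::comm_ring_1) mpoly \<Rightarrow> 'k"
  by unfold_locales
    (auto simp: const_coeff_mult, auto simp: const_coeff_def lookup_add lookup_one)

lemma const_coeff_span_var: "p \<in> ideal.span (range var) \<Longrightarrow> const_coeff p = 0"
proof (induction rule: ideal.span_induct_alt)
  case (step c x y)
  then obtain i where "x = var i" by auto
  moreover have "const_coeff (var i :: ('a, 'b) mpoly) = 0"
    by (auto simp: const_coeff_def var_def lookup_single when_def single_zero
        dest: arg_cong[of _ _ "\<lambda>m. Poly_Mapping.lookup m i"])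
  ultimately show ?case using step by (simp add: const_coeff.hom_add const_coeff_mult)
qed simp

text \<open>Minimality is expressed as vanishing of the differentials over the residue field, the
  form in which homotopy terms drop out. The grading is forgotten.\<close>

definition minimal_resolution ::
  "('n, 'k::field) mpoly set \<Rightarrow> (nat \<Rightarrow> nat) \<Rightarrow> (nat \<Rightarrow> ('n, 'k) mpoly mat) \<Rightarrow> bool" where
  "minimal_resolution J b A \<longleftrightarrow> b 0 = 1 \<and> free_resolution b A \<and>
     {(A 1 *\<^sub>v v) $ 0 | v. v \<in> carrier_vec (b 1)} = J \<and>
     (\<forall>i. map_mat const_coeff (A (Suc i)) = 0\<^sub>m (b i) (b (Suc i)))"

lemma minimal_resolution_if_graded:
  assumes "minimal_graded_resolution J b D A"
  shows "minimal_resolution J b A"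
proof -
  note m = assms[unfolded minimal_graded_resolution_def]
  have "\<forall>i\<ge>1. A i \<in> carrier_mat (b (i - 1)) (b i)" using m by (elim conjE)
  from this[rule_format, of "Suc _"] have c: "A (Suc i) \<in> carrier_mat (b i) (b (Suc i))" for i by simp
  have "\<forall>i\<ge>1. \<forall>r<b (i - 1). \<forall>c<b i. A i $$ (r, c) \<in> ideal.span (range var)" using m by (elim conjE)
  from this[rule_format, of "Suc _"]
  have "A (Suc i) $$ (r, s) \<in> ideal.span (range var)" if "r < b i" "s < b (Suc i)" for i r s
    using that by simp
  then have "map_mat const_coeff (A (Suc i)) = 0\<^sub>m (b i) (b (Suc i))" for i
    using c[of i] by (intro eq_matI) (auto simp: const_coeff_span_var)
  moreover have "free_resolution b A" unfolding free_resolution_def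
  proof (intro conjI allI)
    fix i
    have "\<forall>i\<ge>1. mat_kernel (A i) = {A (i + 1) *\<^sub>v w | w. w \<in> carrier_vec (b (i + 1))}" using m by (elim conjE)
    from this[rule_format, of "Suc i"] show "mat_kernel (A (Suc i)) =
        {A (Suc (Suc i)) *\<^sub>v w | w. w \<in> carrier_vec (b (Suc (Suc i)))}" by simp
  qed (rule c)
  moreover have "b 0 = 1" using m by (elim conjE)
  moreover have "{(A 1 *\<^sub>v v) $ 0 | v. v \<in> carrier_vec (b 1)} = J" using m by (elim conjE)
  ultimately show ?thesis by (simp only: minimal_resolution_def simp_thms)
qed

text \<open>\<open>g i * f i\<close> is homotopic to the identity. Both homotopy terms contain a
  differential of \<open>A\<close>, so they vanish under \<open>const_coeff\<close>; the reductions
  of \<open>g i\<close> and \<open>f i\<close> then multiply to 1 over the field, which bounds the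
  rank. Exchanging the resolutions gives equality.\<close>

lemma minimal_resolution_rank_le:
  assumes mA: "minimal_resolution J a A" and mB: "minimal_resolution J b B"
  shows "a i \<le> b i"
proof (cases i)
  case 0 then show ?thesis using mA mB by (simp add: minimal_resolution_def)
next
  case (Suc i')
  from mA mB have a0: "a 0 = 1" and b0: "b 0 = 1" and A: "free_resolution a A" and B: "free_resolution b B"
    and J: "{(A 1 *\<^sub>v v) $ 0 | v. v \<in> carrier_vec (a 1)} = {(B 1 *\<^sub>v v) $ 0 | v. v \<in> carrier_vec (b 1)}"
    and zA: "\<And>i. map_mat const_coeff (A (Suc i)) = 0\<^sub>m (a i) (a (Suc i))"
    by (auto simp: minimal_resolution_def)
  note cA = free_resolution_carrier[OF A] and cB = free_resolution_carrier[OF B]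
  have im: "\<exists>w\<in>carrier_vec m. M *\<^sub>v w = 1\<^sub>m 1 *\<^sub>v (N *\<^sub>v v)"
    if "v \<in> carrier_vec n" "N \<in> carrier_mat 1 n" "M \<in> carrier_mat 1 m"
      "{(N *\<^sub>v v) $ 0 | v. v \<in> carrier_vec n} \<subseteq> {(M *\<^sub>v v) $ 0 | v. v \<in> carrier_vec m}"
    for n m v and N M :: "('a, 'b) mpoly mat"
  proof -
    from that obtain w where w: "w \<in> carrier_vec m" "(N *\<^sub>v v) $ 0 = (M *\<^sub>v w) $ 0" by blast
    have "1\<^sub>m 1 *\<^sub>v (N *\<^sub>v v) = N *\<^sub>v v" by (rule one_mult_mat_vec) (use that in auto)
    also have "\<dots> = M *\<^sub>v w" using that w by (intro eq_vecI) auto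
    finally show ?thesis using w by metis
  qed
  obtain f where f0: "f 0 = 1\<^sub>m 1" and fc: "\<And>i. f i \<in> carrier_mat (b i) (a i)"
    and f: "\<And>i. B (Suc i) * f (Suc i) = f i * A (Suc i)"
    by (rule lift_chain_map[where A = A and a = a, OF cA free_resolution_comp[OF A] B, of "1\<^sub>m 1"])
       (use a0 b0 im J cA[of 0] cB[of 0] in auto)
  obtain g where g0: "g 0 = 1\<^sub>m 1" and gc: "\<And>i. g i \<in> carrier_mat (a i) (b i)"
    and g: "\<And>i. A (Suc i) * g (Suc i) = g i * B (Suc i)"
    by (rule lift_chain_map[where A = B and a = b, OF cB free_resolution_comp[OF B] A, of "1\<^sub>m 1"])
       (use a0 b0 im J cA[of 0] cB[of 0] in auto)
  define p where "p i = g i * f i - 1\<^sub>m (a i)" for i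
  have gf: "g i * f i \<in> carrier_mat (a i) (a i)" for i using fc gc by (metis mult_carrier_mat)
  have p: "p i \<in> carrier_mat (a i) (a i)" for i unfolding p_def by (simp add: minus_carrier_mat)
  have ch: "A (Suc i) * p (Suc i) = p i * A (Suc i)" for i
  proof -
    have "A (Suc i) * p (Suc i) = A (Suc i) * (g (Suc i) * f (Suc i)) - A (Suc i) * 1\<^sub>m (a (Suc i))"
      unfolding p_def by (rule mult_minus_distrib_mat[OF cA gf one_carrier_mat])
    also have "A (Suc i) * (g (Suc i) * f (Suc i)) = (g i * B (Suc i)) * f (Suc i)"
      using assoc_mult_mat[OF cA gc fc] g by simp
    also have "\<dots> = g i * (f i * A (Suc i))" using assoc_mult_mat[OF gc cB fc] f by simp
    also have "\<dots> = (g i * f i) * A (Suc i)" using assoc_mult_mat[OF gc fc cA] by simp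
    also have "A (Suc i) * 1\<^sub>m (a (Suc i)) = 1\<^sub>m (a i) * A (Suc i)"
      using right_mult_one_mat[OF cA] left_mult_one_mat[OF cA] by simp
    also have "g i * f i * A (Suc i) - 1\<^sub>m (a i) * A (Suc i) = p i * A (Suc i)"
      unfolding p_def by (rule minus_mult_distrib_mat[OF gf one_carrier_mat cA, symmetric])
    finally show ?thesis .
  qed
  have "p 0 = 0\<^sub>m (a 0) (a 0)" unfolding p_def f0 g0 a0 by (intro eq_matI) auto
  from null_homotopy[OF A p this ch] obtain h where hc: "\<And>i. h i \<in> carrier_mat (a (Suc i)) (a i)"
    and h: "\<And>i. p (Suc i) = A (Suc (Suc i)) * h (Suc i) + h i * A (Suc i)" by metis
  let ?c = "map_mat (const_coeff :: ('a, 'b) mpoly \<Rightarrow> 'b)"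
  have "?c (p i) = ?c (A (Suc (Suc i')) * h (Suc i')) + ?c (h i' * A (Suc i'))"
    unfolding Suc h using hc[of i'] hc[of "Suc i'"] cA[of i'] cA[of "Suc i'"] by (intro eq_matI) (auto simp: const_coeff.hom_add)
  also have "\<dots> = ?c (A (Suc (Suc i'))) * ?c (h (Suc i')) + ?c (h i') * ?c (A (Suc i'))"
    using const_coeff.mat_hom_mult[OF cA hc] const_coeff.mat_hom_mult[OF hc cA] by simp
  also have "\<dots> = 0\<^sub>m (a i) (a i)" unfolding zA Suc using hc[of i'] hc[of "Suc i'"] by (intro eq_matI) (auto simp: scalar_prod_def)
  finally have "?c (p i) = 0\<^sub>m (a i) (a i)" .
  moreover have "?c (p i) = ?c (g i) * ?c (f i) - 1\<^sub>m (a i)"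
    unfolding const_coeff.mat_hom_mult[OF gc fc, symmetric] p_def
    using fc[of i] gc[of i] by (intro eq_matI) (auto simp: const_coeff.hom_minus)
  ultimately have z: "?c (g i) * ?c (f i) - 1\<^sub>m (a i) = 0\<^sub>m (a i) (a i)" by simp
  have "?c (g i) * ?c (f i) = 1\<^sub>m (a i)"
  proof (rule eq_matI)
    fix r s assume rs: "r < dim_row (1\<^sub>m (a i) :: 'b mat)" "s < dim_col (1\<^sub>m (a i) :: 'b mat)"
    then show "(?c (g i) * ?c (f i)) $$ (r, s) = 1\<^sub>m (a i) $$ (r, s)"
      using arg_cong[OF z, of "\<lambda>M. M $$ (r, s)"] by simp
  qed (use fc[of i] gc[of i] in auto)
  then show ?thesis
    using left_inverse_dim_le[of "?c (g i)" "a i" "b i" "?c (f i)"] fc gc by simp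
qed

lemma betti_eqI:
  assumes "minimal_graded_resolution J b D A"
  shows "betti J i = b i"
  unfolding betti_def
proof (rule the_equality)
  fix r assume "\<exists>b D A. minimal_graded_resolution J b D A \<and> b i = r"
  then show "r = b i"
    using assms minimal_resolution_if_graded minimal_resolution_rank_le by (metis order_antisym)
qed (use assms in blast)

section \<open>Mapping cones of linear resolutions\<close>

lemma mon_deg_add: "mon_deg (m + m') = mon_deg m + mon_deg m'"
  by (simp add: mon_deg_def lookup_add sum.distrib)

lemma mon_deg_single: "mon_deg (Poly_Mapping.single i a) = a"
  by (simp add: mon_deg_def lookup_single when_def)

lemma homogeneous_zero: "homogeneous d 0"
  by (simp add: homogeneous_def)

lemma homogeneous_single: "homogeneous (int (mon_deg m)) (Poly_Mapping.single m c)"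
  by (auto simp: homogeneous_def split: if_splits)

lemma homogeneous_var: "homogeneous 1 (var i)"
  using homogeneous_single[of "Poly_Mapping.single i 1" 1] by (simp add: var_def mon_deg_single)

definition hcomp :: "nat \<Rightarrow> ('n::finite, 'k::comm_ring_1) mpoly \<Rightarrow> ('n, 'k) mpoly" where
  "hcomp e p = Poly_Mapping.mapp (\<lambda>m c. c when mon_deg m = e) p"

lemma lookup_hcomp: "Poly_Mapping.lookup (hcomp e p) m = (Poly_Mapping.lookup p m when mon_deg m = e)"
  by (auto simp: hcomp_def lookup_mapp when_def in_keys_iff)

lemma hcomp_add: "hcomp e (p + q) = hcomp e p + hcomp e q"
  by (rule poly_mapping_eqI) (simp add: lookup_hcomp lookup_add when_add_distrib)

lemma hcomp_uminus: "hcomp e (- p) = - hcomp e p"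
  by (rule poly_mapping_eqI) (simp add: lookup_hcomp when_uminus_distrib)

lemma hcomp_zero: "hcomp e 0 = 0"
  by (rule poly_mapping_eqI) (simp add: lookup_hcomp)

lemma hcomp_sum: "hcomp e (\<Sum>x\<in>X. f x) = (\<Sum>x\<in>X. hcomp e (f x))"
  by (induction X rule: infinite_finite_induct) (simp_all add: hcomp_zero hcomp_add)

lemma hcomp_homogeneous: "homogeneous (int e) p \<Longrightarrow> hcomp e p = p"
  by (rule poly_mapping_eqI) (auto simp: lookup_hcomp when_def homogeneous_def in_keys_iff)

lemma homogeneous_hcomp: "homogeneous (int e) (hcomp e p)"
  by (auto simp: homogeneous_def in_keys_iff lookup_hcomp when_def split: if_splits)

text \<open>The part of \<open>p\<close> outside degree \<open>e\<close> contributes nothing to the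
  product in degree \<open>d + e\<close>. This allows chain equations with homogeneous differentials
  to be cut down to one degree.\<close>

lemma hcomp_mult:
  assumes a: "homogeneous (int d) a"
  shows "hcomp (d + e) (a * p) = a * hcomp e p"
proof -
  define q where "q = p - hcomp e p"
  have "homogeneous (int (d + e)) (a * hcomp e p)"
    using keys_mult[of a "hcomp e p"] a homogeneous_hcomp[of e p]
    by (fastforce simp: homogeneous_def mon_deg_add)
  then have 1: "hcomp (d + e) (a * hcomp e p) = a * hcomp e p" by (rule hcomp_homogeneous)
  have q: "mon_deg m \<noteq> e" if "m \<in> Poly_Mapping.keys q" for m
    using that by (auto simp: q_def in_keys_iff lookup_minus lookup_hcomp when_def split: if_splits)
  have "mon_deg m \<noteq> d + e" if "m \<in> Poly_Mapping.keys (a * q)" for m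
    using that keys_mult[of a q] a q by (fastforce simp: homogeneous_def mon_deg_add)
  then have 2: "hcomp (d + e) (a * q) = 0"
    by (intro poly_mapping_eqI) (auto simp: lookup_hcomp when_def in_keys_iff)
  have "a * p = a * hcomp e p + a * q" by (simp add: q_def algebra_simps)
  then show ?thesis using 1 2 by (simp add: hcomp_add)
qed

lemma single_mem_ideal_if_factor:
  assumes "var i \<in> ideal.span B" "Poly_Mapping.lookup m i > 0"
  shows "Poly_Mapping.single m c \<in> ideal.span B"
proof -
  have "m = (m - Poly_Mapping.single i 1) + Poly_Mapping.single i 1"
    using assms(2) by (intro poly_mapping_eqI) (auto simp: lookup_add lookup_minus lookup_single when_def)
  then have "Poly_Mapping.single m c = Poly_Mapping.single (m - Poly_Mapping.single i 1) c * var i"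
    by (simp add: var_def mult_single)
  then show ?thesis using ideal.span_scale[OF assms(1)] by simp
qed

lemma poly_mapping_sum_singles:
  "p = (\<Sum>m\<in>Poly_Mapping.keys p. Poly_Mapping.single m (Poly_Mapping.lookup p m))"
  by (rule poly_mapping_eqI)
    (auto simp: lookup_sum lookup_single when_def in_keys_iff)

lemma mem_ideal_if_monomials_mem:
  assumes "\<And>m c. m \<in> Poly_Mapping.keys p \<Longrightarrow> Poly_Mapping.single m c \<in> ideal.span B"
  shows "p \<in> ideal.span B"
  by (subst poly_mapping_sum_singles) (intro ideal.span_sum assms)

lemma homogeneous_mem_span_var:
  assumes "homogeneous d p" "d > 0"
  shows "p \<in> ideal.span (range var)"
proof (rule mem_ideal_if_monomials_mem)
  fix m c assume "m \<in> Poly_Mapping.keys p"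
  then have "mon_deg m > 0" using assms by (auto simp: homogeneous_def)
  then obtain i where "Poly_Mapping.lookup m i > 0"
    unfolding mon_deg_def by (metis not_gr_zero sum.neutral)
  moreover have "var i \<in> ideal.span (range var)" by (simp add: ideal.span_base)
  ultimately show "Poly_Mapping.single m c \<in> ideal.span (range var)"
    by (intro single_mem_ideal_if_factor)
qed

text \<open>\<open>d\<close> is the common degree of the generators, and all later differentials
  have linear entries. The degree shifts are thus determined by the position, and no list of shifts
  has to be carried through the cones.\<close>

definition linear_resolution ::
  "('n::finite, 'k::field) mpoly set \<Rightarrow> nat \<Rightarrow> (nat \<Rightarrow> nat) \<Rightarrow> (nat \<Rightarrow> ('n, 'k) mpoly mat) \<Rightarrow> bool" where
  "linear_resolution J d b A \<longleftrightarrow> b 0 = 1 \<and> free_resolution b A \<and>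
     {(A 1 *\<^sub>v v) $ 0 | v. v \<in> carrier_vec (b 1)} = J \<and>
     (\<forall>i. \<forall>r<b i. \<forall>s<b (Suc i). homogeneous (if i = 0 then int d else 1) (A (Suc i) $$ (r, s)))"

text \<open>All entries have positive degree, hence lie in the ideal of the variables: minimality is
  automatic. Position \<open>i\<close> is generated in degree \<open>d + i - 1\<close> for
  \<open>i\<close> at least 1.\<close>

lemma minimal_graded_resolution_if_linear:
  fixes J :: "('n::finite, 'k::field) mpoly set"
  assumes L: "linear_resolution J d b A" and d: "d > 0" and len: "\<And>i. i > CARD('n) \<Longrightarrow> b i = 0"
  shows "minimal_graded_resolution J b (\<lambda>i s. if i = 0 then 0 else int d + int i - 1) A"
proof -
  have b0: "b 0 = 1" and F: "free_resolution b A"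
    and im: "{(A 1 *\<^sub>v v) $ 0 | v. v \<in> carrier_vec (b 1)} = J"
    and h: "\<And>i r s. r < b i \<Longrightarrow> s < b (Suc i) \<Longrightarrow> homogeneous (if i = 0 then int d else 1) (A (Suc i) $$ (r, s))"
    using L unfolding linear_resolution_def by blast+
  have suc: "(\<forall>i\<ge>1. P i) \<longleftrightarrow> (\<forall>i. P (Suc i))" for P :: "nat \<Rightarrow> bool"
    by (metis One_nat_def Suc_le_D Suc_le_mono zero_le)
  have m: "A (Suc i) $$ (r, s) \<in> ideal.span (range var)" if "r < b i" "s < b (Suc i)" for i r s
    using homogeneous_mem_span_var[OF h[OF that]] d by (simp split: if_splits)
  have h': "homogeneous ((if Suc i = 0 then 0 else int d + int (Suc i) - 1) -
      (if Suc i - 1 = 0 then 0 else int d + int (Suc i - 1) - 1)) (A (Suc i) $$ (r, s))"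
    if "r < b (Suc i - 1)" "s < b (Suc i)" for i r s
    using h[of r i s] that by auto
  show ?thesis unfolding minimal_graded_resolution_def suc
    by (intro conjI allI impI h') (use b0 im F m len in \<open>auto simp: free_resolution_def\<close>)
qed

section \<open>Block matrices and the mapping cone\<close>

lemma zero_mat_mult_vec: "v \<in> carrier_vec m \<Longrightarrow> 0\<^sub>m n m *\<^sub>v v = 0\<^sub>v n"
  by (intro eq_vecI) auto

lemma four_block_upper_mult_vec:
  fixes A :: "'a::comm_ring_1 mat"
  assumes A: "A \<in> carrier_mat n1 m1" and B: "B \<in> carrier_mat n1 m2" and C: "C \<in> carrier_mat n2 m2"
    and v: "v \<in> carrier_vec m1" and w: "w \<in> carrier_vec m2"
  shows "four_block_mat A B (0\<^sub>m n2 m1) C *\<^sub>v (v @\<^sub>v w) = (A *\<^sub>v v + B *\<^sub>v w) @\<^sub>v (C *\<^sub>v w)"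
proof -
  have "0\<^sub>m n2 m1 *\<^sub>v v + C *\<^sub>v w = C *\<^sub>v w" using v w C by (intro eq_vecI) auto
  then show ?thesis using four_block_mat_mult_vec[OF A B zero_carrier_mat C v w] by simp
qed

lemma zero_vec_append: "0\<^sub>v (n + m) = 0\<^sub>v n @\<^sub>v 0\<^sub>v m"
  by (intro eq_vecI) auto

text \<open>Multiplication by \<open>u\<close> maps \<open>J''\<close> into \<open>J'\<close> and
  lifts to a chain map, but the lift comes without control of degrees. Keeping its component of
  degree \<open>d\<close> in position 0 and of degree 1 elsewhere preserves the chain equations.
  Lifting from the negated complex \<open>- C i\<close> produces the sign that makes the cone a
  complex.\<close>

lemma linear_chain_map:
  fixes C A :: "nat \<Rightarrow> ('n::finite, 'k::field) mpoly mat"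
  assumes LA: "linear_resolution J' d b A" and LC: "linear_resolution J'' 1 c C"
    and col: "\<And>f. f \<in> J'' \<Longrightarrow> f * u \<in> J'" and u: "homogeneous (int d) u"
  obtains f where "\<And>i. f i \<in> carrier_mat (b i) (c i)" "f 0 = mat 1 1 (\<lambda>_. u)"
    "\<And>i. A (Suc i) * f (Suc i) = - (f i * C (Suc i))"
    "\<And>i r s. r < b i \<Longrightarrow> s < c i \<Longrightarrow> homogeneous (if i = 0 then int d else 1) (f i $$ (r, s))"
proof -
  have b0: "b 0 = 1" and FA: "free_resolution b A"
    and imA: "{(A 1 *\<^sub>v v) $ 0 | v. v \<in> carrier_vec (b 1)} = J'"
    and hA: "\<And>i r s. r < b i \<Longrightarrow> s < b (Suc i) \<Longrightarrow> homogeneous (if i = 0 then int d else 1) (A (Suc i) $$ (r, s))"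
    using LA unfolding linear_resolution_def by blast+
  have c0: "c 0 = 1" and FC: "free_resolution c C"
    and imC: "{(C 1 *\<^sub>v v) $ 0 | v. v \<in> carrier_vec (c 1)} = J''"
    and hC': "\<And>i r s. r < c i \<Longrightarrow> s < c (Suc i) \<Longrightarrow> homogeneous (if i = 0 then int 1 else 1) (C (Suc i) $$ (r, s))"
    using LC unfolding linear_resolution_def by blast+
  have hC: "homogeneous 1 (C (Suc i) $$ (r, s))" if "r < c i" "s < c (Suc i)" for i r s
    using hC'[OF that] by (cases "i = 0") simp_all
  note cA = free_resolution_carrier[OF FA] and cC = free_resolution_carrier[OF FC]
  let ?f0 = "mat 1 1 (\<lambda>_. u)"
  have im: "\<exists>w\<in>carrier_vec (b 1). A 1 *\<^sub>v w = ?f0 *\<^sub>v (- C 1 *\<^sub>v v)" if v: "v \<in> carrier_vec (c 1)" for v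
  proof -
    have C1: "C 1 \<in> carrier_mat 1 (c 1)" and A1: "A 1 \<in> carrier_mat 1 (b 1)"
      using cC[of 0] cA[of 0] c0 b0 by auto
    have "(C 1 *\<^sub>v (- v)) $ 0 \<in> J''" using imC v by auto
    moreover have e: "- C 1 *\<^sub>v v = C 1 *\<^sub>v (- v)" using C1 v by (intro eq_vecI) auto
    ultimately have "(- C 1 *\<^sub>v v) $ 0 * u \<in> J'" using col by simp
    then obtain w where w: "w \<in> carrier_vec (b 1)" "(A 1 *\<^sub>v w) $ 0 = (- C 1 *\<^sub>v v) $ 0 * u"
      using imA by force
    have "A 1 *\<^sub>v w = ?f0 *\<^sub>v (- C 1 *\<^sub>v v)"
      using w A1 C1 v by (intro eq_vecI) (auto simp: scalar_prod_def[of "vec _ (\<lambda>_. u)"] mult.commute)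
    then show ?thesis using w by blast
  qed
  have "- C (Suc i) * - C (Suc (Suc i)) = 0\<^sub>m (c i) (c (Suc (Suc i)))" for i
    using free_resolution_comp[OF FC, of i] cC[of i] cC[of "Suc i"] by simp
  then obtain g where g0: "g 0 = ?f0" and gc: "\<And>i. g i \<in> carrier_mat (b i) (c i)"
    and g: "\<And>i. A (Suc i) * g (Suc i) = g i * - C (Suc i)"
    using lift_chain_map[where A = "\<lambda>i. - C i" and a = c and b = b and B = A and ?f0.0 = "?f0"]
      cC FA b0 c0 im by (metis mat_carrier uminus_carrier_mat)
  define f where "f i = map_mat (hcomp (if i = 0 then d else 1)) (g i)" for i
  have fc: "f i \<in> carrier_mat (b i) (c i)" for i using gc by (simp add: f_def)
  have f0: "f 0 = ?f0" using u by (intro eq_matI) (auto simp: f_def g0 hcomp_homogeneous)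
  have "A (Suc i) * f (Suc i) = - (f i * C (Suc i))" for i
  proof (rule eq_matI)
    \<comment> \<open>\<open>?e\<close> is the degree of the entries of both
      \<open>A (Suc i)\<close> and \<open>f i\<close>, so both products are compared in degree
      \<open>?e + 1\<close>.\<close>
    let ?e = "if i = 0 then d else 1"
    fix r s assume "r < dim_row (- (f i * C (Suc i)))" "s < dim_col (- (f i * C (Suc i)))"
    then have r: "r < b i" and s: "s < c (Suc i)" using fc[of i] cC[of i] by auto
    have "(A (Suc i) * f (Suc i)) $$ (r, s)
        = (\<Sum>k = 0..<b (Suc i). A (Suc i) $$ (r, k) * hcomp 1 (g (Suc i) $$ (k, s)))"
      using r s cA[of i] gc[of "Suc i"] by (auto simp: f_def scalar_prod_def intro!: sum.cong)
    also have "\<dots> = (\<Sum>k = 0..<b (Suc i). hcomp (?e + 1) (A (Suc i) $$ (r, k) * g (Suc i) $$ (k, s)))"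
      using hA[OF r] by (intro sum.cong refl hcomp_mult[symmetric]) (auto split: if_splits)
    also have "\<dots> = hcomp (?e + 1) ((A (Suc i) * g (Suc i)) $$ (r, s))"
      using r s cA[of i] gc[of "Suc i"] by (auto simp: hcomp_sum scalar_prod_def intro!: sum.cong)
    also have "\<dots> = hcomp (1 + ?e) (- (g i * C (Suc i)) $$ (r, s))"
      unfolding g using r s gc[of i] cC[of i] by (simp add: add.commute)
    also have "\<dots> = - (\<Sum>k = 0..<c i. hcomp (1 + ?e) (C (Suc i) $$ (k, s) * g i $$ (r, k)))"
      using r s gc[of i] cC[of i]
      by (auto simp: hcomp_sum hcomp_uminus scalar_prod_def mult.commute intro!: sum.cong)
    also have "\<dots> = - (\<Sum>k = 0..<c i. C (Suc i) $$ (k, s) * hcomp ?e (g i $$ (r, k)))"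
      using hC[OF _ s] by (intro arg_cong[of _ _ uminus] sum.cong refl hcomp_mult) auto
    also have "\<dots> = (- (f i * C (Suc i))) $$ (r, s)"
      using r s gc[of i] cC[of i] by (auto simp: f_def scalar_prod_def mult.commute intro!: sum.cong)
    finally show "(A (Suc i) * f (Suc i)) $$ (r, s) = (- (f i * C (Suc i))) $$ (r, s)" .
  qed (use fc[of i] fc[of "Suc i"] cC[of i] cA[of i] in auto)
  moreover have "homogeneous (if i = 0 then int d else 1) (f i $$ (r, s))"
    if "r < b i" "s < c i" for i r s
    using that gc[of i] homogeneous_hcomp[of "if i = 0 then d else 1"] by (auto simp: f_def split: if_splits)
  ultimately show ?thesis using that fc f0 by blast
qed

text \<open>Multiplication by \<open>u\<close> embeds S/J'', shifted by \<open>d\<close>, into S/J'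
  with cokernel S/(J' + (u)), so the cone of a lift resolves the cokernel. The ranks
  \<open>c\<close> enter one position later, and position 0 remains S. Linearity survives because
  the lift has the degrees given by \<open>linear_chain_map\<close>.\<close>

lemma linear_resolution_cone:
  fixes J' J'' :: "('n::finite, 'k::field) mpoly set"
  assumes LA: "linear_resolution J' d b A" and LC: "linear_resolution J'' 1 c C"
    and col: "J'' = {f. f * u \<in> J'}" and u: "homogeneous (int d) u"
  shows "\<exists>E. linear_resolution {p + q * u | p q. p \<in> J'} d (\<lambda>i. b i + (if i = 0 then 0 else c (i - 1))) E"
proof -
  have b0: "b 0 = 1" and FA: "free_resolution b A"
    and imA: "{(A 1 *\<^sub>v v) $ 0 | v. v \<in> carrier_vec (b 1)} = J'"
    and hA: "\<And>i r s. r < b i \<Longrightarrow> s < b (Suc i) \<Longrightarrow> homogeneous (if i = 0 then int d else 1) (A (Suc i) $$ (r, s))"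
    using LA unfolding linear_resolution_def by blast+
  have c0: "c 0 = 1" and FC: "free_resolution c C"
    and imC: "{(C 1 *\<^sub>v v) $ 0 | v. v \<in> carrier_vec (c 1)} = J''"
    and hC': "\<And>i r s. r < c i \<Longrightarrow> s < c (Suc i) \<Longrightarrow> homogeneous (if i = 0 then int 1 else 1) (C (Suc i) $$ (r, s))"
    using LC unfolding linear_resolution_def by blast+
  have hC: "homogeneous 1 (C (Suc i) $$ (r, s))" if "r < c i" "s < c (Suc i)" for i r s
    using hC'[OF that] by (cases "i = 0") simp_all
  note cA = free_resolution_carrier[OF FA] and cC = free_resolution_carrier[OF FC]
  obtain f where fc: "\<And>i. f i \<in> carrier_mat (b i) (c i)" and f0: "f 0 = mat 1 1 (\<lambda>_. u)"
    and f: "\<And>i. A (Suc i) * f (Suc i) = - (f i * C (Suc i))"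
    and hf: "\<And>i r s. r < b i \<Longrightarrow> s < c i \<Longrightarrow> homogeneous (if i = 0 then int d else 1) (f i $$ (r, s))"
    using linear_chain_map[OF LA LC _ u] col by blast
  \<comment> \<open>The shifted complex is empty in position 0. So \<open>C' 0\<close> has no rows
    and one column, as \<open>c 0 = 1\<close>, and the block form of \<open>E 1\<close> needs no
    separate treatment.\<close>
  define c' where "c' i = (if i = 0 then 0 else c (i - 1))" for i
  define C' where "C' i = (if i = 0 then 0\<^sub>m 0 1 else C i)" for i
  define E where "E i = four_block_mat (A i) (f (i - 1)) (0\<^sub>m (c' (i - 1)) (b i)) (C' (i - 1))" for i
  have cC': "C' i \<in> carrier_mat (c' i) (c i)" for i
    using cC[of "i - 1"] c0 by (auto simp: C'_def c'_def)
  have c'_Suc: "c' (Suc i) = c i" and C'_Suc: "C' (Suc i) = C (Suc i)" for i by (simp_all add: c'_def C'_def)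
  have E: "E (Suc i) = four_block_mat (A (Suc i)) (f i) (0\<^sub>m (c' i) (b (Suc i))) (C' i)" for i
    by (simp add: E_def)
  have cE: "E (Suc i) \<in> carrier_mat (b i + c' i) (b (Suc i) + c' (Suc i))" for i
    unfolding E c'_Suc by (rule four_block_carrier_mat[OF cA cC'])
  have Ev: "E (Suc i) *\<^sub>v (v @\<^sub>v w) = (A (Suc i) *\<^sub>v v + f i *\<^sub>v w) @\<^sub>v (C' i *\<^sub>v w)"
    if "v \<in> carrier_vec (b (Suc i))" "w \<in> carrier_vec (c i)" for i v w
    unfolding E by (rule four_block_upper_mult_vec[OF cA fc cC' that])
  have C'C: "C' i *\<^sub>v (C (Suc i) *\<^sub>v w) = 0\<^sub>v (c' i)" if w: "w \<in> carrier_vec (c (Suc i))" for i w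
  proof (cases i)
    case 0 then show ?thesis by (intro eq_vecI) (auto simp: C'_def c'_def)
  next
    case (Suc j)
    have "C i *\<^sub>v (C (Suc i) *\<^sub>v w) = (C (Suc j) * C (Suc (Suc j))) *\<^sub>v w"
      unfolding Suc using assoc_mult_mat_vec[OF cC cC, of w j] w Suc by simp
    then show ?thesis unfolding free_resolution_comp[OF FC] using w Suc by (simp add: C'_def c'_def zero_mat_mult_vec)
  qed
  have FE: "free_resolution (\<lambda>i. b i + c' i) E" unfolding free_resolution_def
  proof (intro conjI allI)
    fix i show "E (Suc i) \<in> carrier_mat (b i + c' i) (b (Suc i) + c' (Suc i))" by (rule cE)
  next
    fix i
    show "mat_kernel (E (Suc i)) =
      {E (Suc (Suc i)) *\<^sub>v w |w. w \<in> carrier_vec (b (Suc (Suc i)) + c' (Suc (Suc i)))}" (is "_ = ?R")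
    proof (intro subset_antisym subsetI)
      fix x assume "x \<in> ?R"
      then obtain y where y: "y \<in> carrier_vec (b (Suc (Suc i)) + c (Suc i))" and x: "x = E (Suc (Suc i)) *\<^sub>v y"
        unfolding c'_Suc by blast
      define v w where "v = vec_first y (b (Suc (Suc i)))" and "w = vec_last y (c (Suc i))"
      have y': "y = v @\<^sub>v w" and v: "v \<in> carrier_vec (b (Suc (Suc i)))" and w: "w \<in> carrier_vec (c (Suc i))"
        using y by (simp_all add: v_def w_def)
      let ?p = "A (Suc (Suc i)) *\<^sub>v v" and ?q = "f (Suc i) *\<^sub>v w" and ?r = "C (Suc i) *\<^sub>v w"
      have pc: "?p \<in> carrier_vec (b (Suc i))" "?q \<in> carrier_vec (b (Suc i))" "?r \<in> carrier_vec (c i)"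
        using cA[of "Suc i"] fc[of "Suc i"] cC[of i] v w by auto
      have xx: "x = (?p + ?q) @\<^sub>v ?r" unfolding x y' using Ev[OF v w] by (simp add: C'_Suc)
      have "A (Suc i) *\<^sub>v ?p = (A (Suc i) * A (Suc (Suc i))) *\<^sub>v v"
        using assoc_mult_mat_vec[OF cA cA v] by simp
      then have p0: "A (Suc i) *\<^sub>v ?p = 0\<^sub>v (b i)" unfolding free_resolution_comp[OF FA] using v by (simp add: zero_mat_mult_vec)
      have "A (Suc i) *\<^sub>v ?q = (A (Suc i) * f (Suc i)) *\<^sub>v w"
        using assoc_mult_mat_vec[OF cA fc w] by simp
      also have "\<dots> = - (f i *\<^sub>v ?r)" unfolding f using assoc_mult_mat_vec[OF fc cC w] fc[of i] cC[of i] w by simp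
      finally have q0: "A (Suc i) *\<^sub>v ?q = - (f i *\<^sub>v ?r)" .
      have "A (Suc i) *\<^sub>v (?p + ?q) + f i *\<^sub>v ?r = 0\<^sub>v (b i)"
        unfolding mult_add_distrib_mat_vec[OF cA pc(1,2)] p0 q0
        using fc[of i] pc by (intro eq_vecI) auto
      then have "E (Suc i) *\<^sub>v x = 0\<^sub>v (b i + c' i)"
        unfolding xx zero_vec_append using Ev[of "?p + ?q" i ?r] pc C'C[OF w] by simp
      moreover have "x \<in> carrier_vec (b (Suc i) + c' (Suc i))" unfolding xx c'_Suc using pc by auto
      ultimately show "x \<in> mat_kernel (E (Suc i))" by (intro mat_kernelI[OF cE])
    next
      fix x assume "x \<in> mat_kernel (E (Suc i))"
      from mat_kernelD[OF cE this]
      have x: "x \<in> carrier_vec (b (Suc i) + c i)" and z: "E (Suc i) *\<^sub>v x = 0\<^sub>v (b i + c' i)"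
        by (simp_all add: c'_Suc)
      define v w where "v = vec_first x (b (Suc i))" and "w = vec_last x (c i)"
      have x': "x = v @\<^sub>v w" and v: "v \<in> carrier_vec (b (Suc i))" and w: "w \<in> carrier_vec (c i)"
        using x by (simp_all add: v_def w_def)
      have Av: "A (Suc i) *\<^sub>v v \<in> carrier_vec (b i)" and fw: "f i *\<^sub>v w \<in> carrier_vec (b i)"
        using cA[of i] fc[of i] v w by auto
      have "(A (Suc i) *\<^sub>v v + f i *\<^sub>v w) @\<^sub>v (C' i *\<^sub>v w) = 0\<^sub>v (b i) @\<^sub>v 0\<^sub>v (c' i)"
        using z Ev[OF v w] unfolding x' zero_vec_append by simp
      then have z1: "A (Suc i) *\<^sub>v v + f i *\<^sub>v w = 0\<^sub>v (b i)" and z2: "C' i *\<^sub>v w = 0\<^sub>v (c' i)"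
        using append_vec_eq[of "A (Suc i) *\<^sub>v v + f i *\<^sub>v w" "b i" "0\<^sub>v (b i)"] Av fw by auto
      have Av_eq: "A (Suc i) *\<^sub>v v = - (f i *\<^sub>v w)"
      proof (rule eq_vecI)
        fix r assume "r < dim_vec (- (f i *\<^sub>v w))"
        then have "r < b i" using fc[of i] by simp
        then show "(A (Suc i) *\<^sub>v v) $ r = (- (f i *\<^sub>v w)) $ r"
          using arg_cong[OF z1, of "\<lambda>x. x $ r"] cA[of i] fc[of i] by (simp add: eq_neg_iff_add_eq_0)
      qed (use cA[of i] fc[of i] in auto)
      \<comment> \<open>In positive positions this is exactness of \<open>C\<close>. For
        \<open>i = 0\<close> the block \<open>C' 0\<close> imposes no condition; instead the upper
        block puts \<open>w $ 0 * u\<close> into \<open>J'\<close>, so \<open>w $ 0\<close> lies in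
        the colon ideal, which is the image of \<open>C 1\<close>.\<close>
      have "\<exists>z\<in>carrier_vec (c (Suc i)). C (Suc i) *\<^sub>v z = w"
      proof (cases i)
        case 0
        have A1: "A 1 \<in> carrier_mat 1 (b 1)" and C1: "C 1 \<in> carrier_mat 1 (c 1)"
          using cA[of 0] cC[of 0] b0 c0 by auto
        have "(A 1 *\<^sub>v (- v)) $ 0 = - (A 1 *\<^sub>v v) $ 0" using A1 v 0 by simp
        also have "\<dots> = w $ 0 * u"
          using Av_eq f0 w c0 unfolding 0 by (simp add: scalar_prod_def mult.commute)
        finally have "w $ 0 * u \<in> J'" using imA v 0 by (metis (mono_tags, lifting) One_nat_def mem_Collect_eq uminus_carrier_vec)
        then have "w $ 0 \<in> J''" using col by simp
        then obtain z where "z \<in> carrier_vec (c 1)" "(C 1 *\<^sub>v z) $ 0 = w $ 0" using imC by force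
        then show ?thesis using C1 w c0 0 by (intro bexI[of _ z] eq_vecI) auto
      next
        case (Suc j)
        then have "w \<in> mat_kernel (C (Suc j))" using z2 w cC[of j]
          by (intro mat_kernelI[OF cC]) (auto simp: C'_def c'_def)
        then show ?thesis unfolding free_resolution_exact[OF FC] using Suc by auto
      qed
      then obtain z where z: "z \<in> carrier_vec (c (Suc i))" and w': "w = C (Suc i) *\<^sub>v z" by blast
      \<comment> \<open>By the sign in \<open>f\<close>, the vectors \<open>v\<close> and
        \<open>?q\<close> have the same image under \<open>A (Suc i)\<close>, so their difference is
        a cycle.\<close>
      let ?q = "f (Suc i) *\<^sub>v z"
      have q: "?q \<in> carrier_vec (b (Suc i))" using fc[of "Suc i"] z by auto
      have "A (Suc i) *\<^sub>v ?q = (A (Suc i) * f (Suc i)) *\<^sub>v z"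
        using assoc_mult_mat_vec[OF cA fc z] by simp
      also have "\<dots> = - (f i *\<^sub>v w)" unfolding f w'
        using assoc_mult_mat_vec[OF fc cC z] fc[of i] cC[of i] z by simp
      finally have "A (Suc i) *\<^sub>v (v - ?q) = 0\<^sub>v (b i)"
        unfolding mult_minus_distrib_mat_vec[OF cA v q] Av_eq using fw by (intro eq_vecI) auto
      then have "v - ?q \<in> mat_kernel (A (Suc i))" using v q by (intro mat_kernelI[OF cA]) auto
      then obtain y where y: "y \<in> carrier_vec (b (Suc (Suc i)))" and vy: "v - ?q = A (Suc (Suc i)) *\<^sub>v y"
        unfolding free_resolution_exact[OF FA] by blast
      have "v = (v - ?q) + ?q" using v q fc[of "Suc i"] by (intro eq_vecI) auto
      then have "x = E (Suc (Suc i)) *\<^sub>v (y @\<^sub>v z)"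
        unfolding x' using Ev[OF y z] vy w' C'_Suc by metis
      then show "x \<in> ?R" using y z unfolding c'_Suc by blast
    qed
  qed
  have im: "{(E 1 *\<^sub>v x) $ 0 | x. x \<in> carrier_vec (b 1 + c' 1)} = {p + q * u | p q. p \<in> J'}"
  proof -
    have E1: "(E 1 *\<^sub>v (v @\<^sub>v w)) $ 0 = (A 1 *\<^sub>v v) $ 0 + w $ 0 * u"
      if "v \<in> carrier_vec (b 1)" "w \<in> carrier_vec 1" for v w
      using Ev[of v 0 w] that c0 b0 cA[of 0] f0 by (auto simp: scalar_prod_def[of _ w] mult.commute)
    show ?thesis
    proof (intro subset_antisym subsetI; elim CollectE exE conjE)
      fix y x assume y: "y = (E 1 *\<^sub>v x) $ 0" and x: "x \<in> carrier_vec (b 1 + c' 1)"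
      have "x = vec_first x (b 1) @\<^sub>v vec_last x 1" using x c0 by (simp add: c'_def)
      then have "y = (A 1 *\<^sub>v vec_first x (b 1)) $ 0 + vec_last x 1 $ 0 * u" using E1 y by (metis vec_first_carrier vec_last_carrier)
      moreover have "(A 1 *\<^sub>v vec_first x (b 1)) $ 0 \<in> J'" using imA by auto
      ultimately show "y \<in> {p + q * u | p q. p \<in> J'}" by blast
    next
      fix y p q assume y: "y = p + q * u" and "p \<in> J'"
      then obtain v where v: "v \<in> carrier_vec (b 1)" "p = (A 1 *\<^sub>v v) $ 0" using imA by blast
      have "y = (E 1 *\<^sub>v (v @\<^sub>v vec 1 (\<lambda>_. q))) $ 0" using E1[OF v(1), of "vec 1 (\<lambda>_. q)"] v y by simp
      moreover have "v @\<^sub>v vec 1 (\<lambda>_. q) \<in> carrier_vec (b 1 + c' 1)" using append_carrier_vec[OF v(1), of _ 1] c0 by (auto simp: c'_def)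
      ultimately show "y \<in> {(E 1 *\<^sub>v x) $ 0 | x. x \<in> carrier_vec (b 1 + c' 1)}" by blast
    qed
  qed
  have hE: "homogeneous (if i = 0 then int d else 1) (E (Suc i) $$ (r, s))"
    if r: "r < b i + c' i" and s: "s < b (Suc i) + c' (Suc i)" for i r s
  proof -
    have C: "homogeneous (if i = 0 then int d else 1) (C' i $$ (r', s'))" if "r' < c' i" "s' < c i" for r' s'
      using that hC[of r' "i - 1" s'] by (cases i) (auto simp: C'_def c'_def)
    have dims: "dim_row (A (Suc i)) = b i" "dim_col (A (Suc i)) = b (Suc i)"
      "dim_row (C' i) = c' i" "dim_col (C' i) = c i"
      using cA[of i] cC'[of i] by auto
    show ?thesis
      using r s hA[of r i s] hf[of r i "s - b (Suc i)"] C[of "r - b i" "s - b (Suc i)"]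
      unfolding E by (auto simp: dims c'_Suc homogeneous_zero)
  qed
  have "linear_resolution {p + q * u | p q. p \<in> J'} d (\<lambda>i. b i + c' i) E"
    unfolding linear_resolution_def using FE im hE b0 by (auto simp: c'_def[of 0])
  then show ?thesis unfolding c'_def by blast
qed

text \<open>Without generators linearity is vacuous for every \<open>d\<close>. This starts both
  inductions over cones: \<open>d = 1\<close> for ideals of variables, and the degree of the
  generators for monomial ideals.\<close>

lemma linear_resolution_zero:
  "\<exists>A. linear_resolution {0 :: ('n::finite, 'k::field) mpoly} d (\<lambda>i. if i = 0 then 1 else 0) A"
proof -
  let ?b = "\<lambda>i :: nat. if i = 0 then 1 else 0 :: nat"
  let ?A = "\<lambda>i. 0\<^sub>m (?b (i - 1)) (?b i) :: ('n, 'k) mpoly mat"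
  have e: "carrier_vec 0 = {0\<^sub>v 0 :: ('n, 'k) mpoly vec}" by (auto intro: eq_vecI)
  have k: "mat_kernel (0\<^sub>m n 0 :: ('n, 'k) mpoly mat) = {0\<^sub>v 0}" for n
    using e by (auto simp: mat_kernel_def)
  have "linear_resolution {0} d ?b ?A"
    unfolding linear_resolution_def free_resolution_def using e k by auto
  then show ?thesis by blast
qed

lemma linear_resolution_span_insert:
  assumes "linear_resolution (ideal.span S) d b A" "linear_resolution J 1 c C"
    and "J = {f. f * u \<in> ideal.span S}" "homogeneous (int d) u"
  shows "\<exists>E. linear_resolution (ideal.span (insert u S)) d (\<lambda>i. b i + (if i = 0 then 0 else c (i - 1))) E"
proof -
  have "ideal.span (insert u S) = {p + q * u | p q. p \<in> ideal.span S}"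
  proof (intro subset_antisym subsetI)
    fix x assume "x \<in> ideal.span (insert u S)"
    then obtain k where "x - k * u \<in> ideal.span S" unfolding ideal.span_insert by blast
    moreover have "x = (x - k * u) + k * u" by simp
    ultimately show "x \<in> {p + q * u | p q. p \<in> ideal.span S}" by blast
  next
    fix x assume "x \<in> {p + q * u | p q. p \<in> ideal.span S}"
    then obtain p q where "x = p + q * u" "p \<in> ideal.span S" by blast
    then have "x - q * u \<in> ideal.span S" by simp
    then show "x \<in> ideal.span (insert u S)" unfolding ideal.span_insert by blast
  qed
  then show ?thesis using linear_resolution_cone[OF assms] by simp
qed

section \<open>Linear quotients\<close>

abbreviation monomial :: "('n \<Rightarrow>\<^sub>0 nat) \<Rightarrow> ('n, 'k::comm_ring_1) mpoly" where
  "monomial m \<equiv> Poly_Mapping.single m 1"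

text \<open>The right-hand side, with \<open>m = h + g\<close> for divisibility, is stable under
  sums and multiples. Colon ideals can therefore be compared on exponent vectors.\<close>

lemma mem_monomial_ideal_iff:
  fixes p :: "('n, 'k::comm_ring_1) mpoly"
  shows "p \<in> ideal.span (monomial ` G) \<longleftrightarrow> (\<forall>m\<in>Poly_Mapping.keys p. \<exists>g\<in>G. \<exists>h. m = h + g)"
proof
  assume "p \<in> ideal.span (monomial ` G)"
  then show "\<forall>m\<in>Poly_Mapping.keys p. \<exists>g\<in>G. \<exists>h. m = h + g"
  proof (induction rule: ideal.span_induct_alt)
    case (step c x y)
    then obtain g where g: "g \<in> G" "x = monomial g" by blast
    show ?case
    proof
      fix m assume "m \<in> Poly_Mapping.keys (c * x + y)"
      then consider "m \<in> Poly_Mapping.keys (c * x)" | "m \<in> Poly_Mapping.keys y"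
        using keys_add[of "c * x" y] by blast
      then show "\<exists>g\<in>G. \<exists>h. m = h + g"
      proof cases
        case 1
        then obtain h where "m = h + g" using keys_mult[of c x] g(2) by (auto split: if_splits)
        then show ?thesis using g(1) by blast
      qed (use step.IH in blast)
    qed
  qed simp
next
  assume r: "\<forall>m\<in>Poly_Mapping.keys p. \<exists>g\<in>G. \<exists>h. m = h + g"
  show "p \<in> ideal.span (monomial ` G)"
  proof (rule mem_ideal_if_monomials_mem)
    fix m c assume "m \<in> Poly_Mapping.keys p"
    then obtain g h where g: "g \<in> G" and m: "m = h + g" using r by blast
    have "Poly_Mapping.single m c = Poly_Mapping.single h c * monomial g" by (simp add: m mult_single)
    moreover have "monomial g \<in> ideal.span (monomial ` G)" using g by (intro ideal.span_base) blast
    ultimately show "Poly_Mapping.single m c \<in> ideal.span (monomial ` G)" using ideal.span_scale by metis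
  qed
qed

text \<open>Adding \<open>u\<close> to exponents is injective, so no two terms of \<open>f\<close>
  merge.\<close>

lemma lookup_mult_monomial:
  fixes f :: "('n, 'k::comm_ring_1) mpoly"
  shows "Poly_Mapping.lookup (f * monomial u) (m + u) = Poly_Mapping.lookup f m"
proof -
  have "(\<Sum>q. Poly_Mapping.lookup (monomial u) q when m + u = l + q) = ((1 :: 'k) when l = m)" for l
  proof -
    have "(\<Sum>q. Poly_Mapping.lookup (monomial u) q when m + u = l + q)
        = (\<Sum>q. ((1 :: 'k) when m + u = l + q) when q = u)"
      by (intro arg_cong[of _ _ Sum_any] ext) (auto simp: lookup_single when_def)
    then show ?thesis by (auto simp: when_def)
  qed
  then show ?thesis by (simp add: lookup_mult mult_when)
qed

lemma keys_mult_monomial: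
  fixes f :: "('n, 'k::comm_ring_1) mpoly"
  shows "Poly_Mapping.keys (f * monomial u) = (\<lambda>m. m + u) ` Poly_Mapping.keys f"
proof (intro subset_antisym subsetI)
  fix x assume "x \<in> Poly_Mapping.keys (f * monomial u)"
  then show "x \<in> (\<lambda>m. m + u) ` Poly_Mapping.keys f" using keys_mult[of f "monomial u"] by (auto split: if_splits)
qed (auto simp: in_keys_iff lookup_mult_monomial)

lemma mem_var_ideal_iff:
  fixes p :: "('n, 'k::comm_ring_1) mpoly"
  shows "p \<in> ideal.span (var ` T) \<longleftrightarrow> (\<forall>m\<in>Poly_Mapping.keys p. \<exists>i\<in>T. Poly_Mapping.lookup m i > 0)"
proof -
  have "(\<exists>h. m = h + Poly_Mapping.single i 1) \<longleftrightarrow> Poly_Mapping.lookup m i > 0" for m :: "'n \<Rightarrow>\<^sub>0 nat" and i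
  proof
    assume "Poly_Mapping.lookup m i > 0"
    then have "m = (m - Poly_Mapping.single i 1) + Poly_Mapping.single i 1"
      by (intro poly_mapping_eqI) (auto simp: lookup_add lookup_minus lookup_single when_def)
    then show "\<exists>h. m = h + Poly_Mapping.single i 1" by blast
  qed (auto simp: lookup_add)
  moreover have "(var ` T :: ('n, 'k) mpoly set) = monomial ` (\<lambda>i. Poly_Mapping.single i 1) ` T" by (auto simp: var_def)
  ultimately show ?thesis by (simp add: mem_monomial_ideal_iff)
qed

text \<open>Iterating the mapping cone over the variables yields the Koszul complex.\<close>

lemma linear_resolution_var_ideal:
  fixes T :: "'n::finite set"
  shows "\<exists>A. linear_resolution (ideal.span (var ` T) :: ('n, 'k::field) mpoly set) 1 (\<lambda>i. card T choose i) A"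
proof (induction T rule: finite_induct[OF finite])
  case 1
  have "(\<lambda>i. card {} choose i) = (\<lambda>i. if i = 0 then 1 else 0)" by auto
  then show ?case using linear_resolution_zero[of 1] by simp
next
  case (2 t T)
  let ?J = "ideal.span (var ` T) :: ('n, 'k) mpoly set"
  obtain A where A: "linear_resolution ?J 1 (\<lambda>i. card T choose i) A" using 2 by blast
  \<comment> \<open>As \<open>t\<close> is not in \<open>T\<close>, a factor \<open>var t\<close>
    never helps divisibility by a variable of \<open>T\<close>. The colon ideal is \<open>?J\<close>
    again, \<open>A\<close> serves on both sides of the cone, and Pascal's rule adds the
    ranks.\<close>
  have "?J = {f. f * var t \<in> ?J}"
  proof -
    have "(\<exists>i\<in>T. 0 < Poly_Mapping.lookup (m + Poly_Mapping.single t 1) i) \<longleftrightarrow> (\<exists>i\<in>T. 0 < Poly_Mapping.lookup m i)"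
      for m :: "'n \<Rightarrow>\<^sub>0 nat"
      using 2(2) by (auto simp: lookup_add lookup_single when_def split: if_splits)
    moreover have "Poly_Mapping.keys (f * var t) = (\<lambda>m. m + Poly_Mapping.single t 1) ` Poly_Mapping.keys f"
      for f :: "('n, 'k) mpoly"
      unfolding var_def by (rule keys_mult_monomial)
    ultimately show ?thesis by (auto simp: mem_var_ideal_iff)
  qed
  from linear_resolution_span_insert[OF A A this] homogeneous_var[of t]
  obtain E where "linear_resolution (ideal.span (insert (var t) (var ` T)) :: ('n, 'k) mpoly set) 1
      (\<lambda>i. (card T choose i) + (if i = 0 then 0 else card T choose (i - 1))) E" by auto
  moreover have "(\<lambda>i. (card T choose i) + (if i = 0 then 0 else card T choose (i - 1)))
      = (\<lambda>i. card (insert t T) choose i)"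
  proof
    fix i show "(card T choose i) + (if i = 0 then 0 else card T choose (i - 1)) = card (insert t T) choose i"
      using 2(1,2) by (cases i) auto
  qed
  ultimately show ?case by auto
qed

section \<open>Capped monomials in lexicographic order\<close>

definition capped :: "nat \<Rightarrow> nat \<Rightarrow> ('n::finite \<Rightarrow>\<^sub>0 nat) set" where
  "capped d a = {m. mon_deg m = d \<and> (\<forall>i. Poly_Mapping.lookup m i \<le> a)}"

lemma lookup_le_mon_deg: "Poly_Mapping.lookup m i \<le> mon_deg m"
  unfolding mon_deg_def by (rule member_le_sum) auto

lemma finite_mon_deg: "finite {m :: 'n::finite \<Rightarrow>\<^sub>0 nat. mon_deg m = d}"
proof (rule finite_imageD)
  show "inj_on Poly_Mapping.lookup {m :: 'n \<Rightarrow>\<^sub>0 nat. mon_deg m = d}"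
    by (rule inj_onI) (rule poly_mapping_eq_iff[THEN iffD2])
  have "Poly_Mapping.lookup ` {m :: 'n \<Rightarrow>\<^sub>0 nat. mon_deg m = d} \<subseteq> PiE UNIV (\<lambda>_. {..d})"
    using lookup_le_mon_deg by auto
  then show "finite (Poly_Mapping.lookup ` {m :: 'n \<Rightarrow>\<^sub>0 nat. mon_deg m = d})"
    by (rule finite_subset) (intro finite_PiE; simp)
qed

lemma finite_capped: "finite (capped d a)"
  by (rule finite_subset[OF _ finite_mon_deg[of d]]) (auto simp: capped_def)

locale variable_order =
  fixes idx :: "'n::finite \<Rightarrow> nat"
  assumes inj_idx: "inj idx"
begin

definition lexgt :: "('n \<Rightarrow>\<^sub>0 nat) \<Rightarrow> ('n \<Rightarrow>\<^sub>0 nat) \<Rightarrow> bool" where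
  "lexgt u v \<longleftrightarrow> (\<exists>p. Poly_Mapping.lookup v p < Poly_Mapping.lookup u p \<and>
     (\<forall>q. idx q < idx p \<longrightarrow> Poly_Mapping.lookup u q = Poly_Mapping.lookup v q))"

lemma lexgt_total:
  assumes "u \<noteq> v" shows "lexgt u v \<or> lexgt v u"
proof -
  have "\<exists>p. Poly_Mapping.lookup u p \<noteq> Poly_Mapping.lookup v p"
    using assms poly_mapping_eqI by metis
  then obtain p where "Poly_Mapping.lookup u p \<noteq> Poly_Mapping.lookup v p"
    "\<And>q. idx q < idx p \<Longrightarrow> Poly_Mapping.lookup u q = Poly_Mapping.lookup v q"
    using ex_has_least_nat[of "\<lambda>p. Poly_Mapping.lookup u p \<noteq> Poly_Mapping.lookup v p" _ idx]
    by (metis not_less)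
  then show ?thesis unfolding lexgt_def by (metis linorder_neqE_nat)
qed

lemma lexgt_trans:
  assumes "lexgt u v" "lexgt v w" shows "lexgt u w"
proof -
  obtain p where p: "Poly_Mapping.lookup v p < Poly_Mapping.lookup u p"
    "\<And>q. idx q < idx p \<Longrightarrow> Poly_Mapping.lookup u q = Poly_Mapping.lookup v q"
    using assms(1) by (auto simp: lexgt_def)
  obtain p' where p': "Poly_Mapping.lookup w p' < Poly_Mapping.lookup v p'"
    "\<And>q. idx q < idx p' \<Longrightarrow> Poly_Mapping.lookup v q = Poly_Mapping.lookup w q"
    using assms(2) by (auto simp: lexgt_def)
  consider "idx p < idx p'" | "p = p'" | "idx p' < idx p"
    using inj_idx by (metis injD linorder_neqE_nat)
  then show ?thesis
  proof cases
    case 1 then show ?thesis using p p' by (auto simp: lexgt_def intro!: exI[of _ p])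
  next
    case 2 then show ?thesis using p p' by (auto simp: lexgt_def intro!: exI[of _ p])
  next
    case 3 then show ?thesis using p p' by (auto simp: lexgt_def intro!: exI[of _ p'])
  qed
qed

lemma lexgt_irrefl: "\<not> lexgt u u"
  by (simp add: lexgt_def)

lemma ex_lex_least:
  assumes "finite G" "G \<noteq> {}"
  shows "\<exists>u\<in>G. \<forall>v\<in>G. v \<noteq> u \<longrightarrow> lexgt v u"
  using assms
proof (induction rule: finite_ne_induct)
  case (insert x F)
  then obtain u where u: "u \<in> F" "\<forall>v\<in>F. v \<noteq> u \<longrightarrow> lexgt v u" by blast
  then have "u \<noteq> x" using insert by blast
  then consider "lexgt u x" | "lexgt x u" using lexgt_total by blast
  then show ?case
  proof cases
    case 1
    then have "\<forall>v\<in>F. lexgt v x" using u lexgt_trans by metis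
    then show ?thesis by blast
  qed (use u in blast)
qed simp

text \<open>The exponent at \<open>i\<close> can be raised below the cap at the expense of a later
  variable. The result is a lexicographically larger capped monomial that divides the product of
  \<open>u\<close> with variable \<open>i\<close>.\<close>

definition colon_vars :: "nat \<Rightarrow> ('n \<Rightarrow>\<^sub>0 nat) \<Rightarrow> 'n set" where
  "colon_vars a u = {i. Poly_Mapping.lookup u i < a \<and> (\<exists>j. idx i < idx j \<and> 0 < Poly_Mapping.lookup u j)}"

lemma exchange_capped:
  assumes u: "u \<in> capped d a" and "Poly_Mapping.lookup u i < a" "idx i < idx j" "0 < Poly_Mapping.lookup u j"
  obtains v where "v \<in> capped d a" "lexgt v u" "u + Poly_Mapping.single i 1 = v + Poly_Mapping.single j 1"
proof -
  define v where "v = u + Poly_Mapping.single i 1 - Poly_Mapping.single j 1"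
  have ij: "i \<noteq> j" using assms by auto
  have e: "u + Poly_Mapping.single i 1 = v + Poly_Mapping.single j 1"
    using assms ij unfolding v_def
    by (intro poly_mapping_eqI) (auto simp: lookup_add lookup_minus lookup_single when_def)
  have "mon_deg v = mon_deg u"
    using arg_cong[OF e, of mon_deg] by (simp add: mon_deg_add mon_deg_single)
  then have "v \<in> capped d a"
    using assms ij by (auto simp: capped_def v_def lookup_add lookup_minus lookup_single when_def)
      (metis Suc_leI le_SucI diff_le_self le_trans)+
  moreover have "lexgt v u"
    unfolding lexgt_def using ij assms
    by (intro exI[of _ i]) (auto simp: v_def lookup_add lookup_minus lookup_single when_def)
  ultimately show ?thesis using that e by blast
qed

text \<open>For a colon variable the exchange yields a larger \<open>v\<close>, which is in
  \<open>G\<close> by upward closure. Conversely let \<open>m + u = h + g\<close> with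
  \<open>g\<close> in \<open>G\<close>, and let \<open>p\<close> be the first place where
  \<open>g\<close> and \<open>u\<close> differ. There \<open>g\<close> is larger, so
  \<open>u\<close> is below the cap and \<open>m\<close> contains \<open>p\<close>; as the degrees
  agree, \<open>u\<close> exceeds \<open>g\<close> at a later variable, so \<open>p\<close> is a
  colon variable.\<close>

lemma colon_upper_set:
  assumes G: "G \<subseteq> capped d a" and up: "\<And>v w. w \<in> insert u G \<Longrightarrow> v \<in> capped d a \<Longrightarrow> lexgt v w \<Longrightarrow> v \<in> insert u G"
    and u: "u \<in> capped d a" and least: "\<And>v. v \<in> G \<Longrightarrow> lexgt v u"
  shows "ideal.span (var ` colon_vars a u) = {f :: ('n, 'k::field) mpoly. f * monomial u \<in> ideal.span (monomial ` G)}"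
proof -
  have "(\<exists>i\<in>colon_vars a u. 0 < Poly_Mapping.lookup m i) \<longleftrightarrow> (\<exists>g\<in>G. \<exists>h. m + u = h + g)" for m
  proof
    assume "\<exists>i\<in>colon_vars a u. 0 < Poly_Mapping.lookup m i"
    then obtain i j where i: "Poly_Mapping.lookup u i < a" "idx i < idx j" "0 < Poly_Mapping.lookup u j"
      and m: "0 < Poly_Mapping.lookup m i" by (auto simp: colon_vars_def)
    obtain v where v: "v \<in> capped d a" "lexgt v u" "u + Poly_Mapping.single i 1 = v + Poly_Mapping.single j 1"
      using exchange_capped[OF u i] by blast
    have "v \<in> G" using up[of u v] v lexgt_irrefl by blast
    moreover have "m = (m - Poly_Mapping.single i 1) + Poly_Mapping.single i 1"
      using m by (intro poly_mapping_eqI) (auto simp: lookup_add lookup_minus lookup_single when_def)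
    then have "m + u = ((m - Poly_Mapping.single i 1) + Poly_Mapping.single j 1) + v"
      using v(3) by (metis (no_types, lifting) add.assoc add.commute)
    ultimately show "\<exists>g\<in>G. \<exists>h. m + u = h + g" by blast
  next
    assume "\<exists>g\<in>G. \<exists>h. m + u = h + g"
    then obtain g h where g: "g \<in> G" and e: "m + u = h + g" by blast
    obtain p where p: "Poly_Mapping.lookup u p < Poly_Mapping.lookup g p"
      "\<And>q. idx q < idx p \<Longrightarrow> Poly_Mapping.lookup g q = Poly_Mapping.lookup u q"
      using least[OF g] by (auto simp: lexgt_def)
    have gB: "mon_deg g = mon_deg u" "Poly_Mapping.lookup g p \<le> a" using g G u by (auto simp: capped_def)
    have "\<exists>j. idx p < idx j \<and> Poly_Mapping.lookup g j < Poly_Mapping.lookup u j"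
    proof (rule ccontr)
      assume n: "\<not> ?thesis"
      have "Poly_Mapping.lookup u q \<le> Poly_Mapping.lookup g q" for q
        using n p inj_idx by (metis injD linorder_neqE_nat not_less order.strict_implies_order order_refl)
      then have "mon_deg u < mon_deg g" unfolding mon_deg_def using p(1)
        by (intro sum_strict_mono_ex1) auto
      then show False using gB by simp
    qed
    then obtain j where j: "idx p < idx j" "0 < Poly_Mapping.lookup u j" by auto
    have "Poly_Mapping.lookup m p + Poly_Mapping.lookup u p = Poly_Mapping.lookup h p + Poly_Mapping.lookup g p"
      using arg_cong[OF e, of "\<lambda>m. Poly_Mapping.lookup m p"] by (simp add: lookup_add)
    then have "0 < Poly_Mapping.lookup m p" using p by linarith
    moreover have "p \<in> colon_vars a u" using p(1) gB(2) j by (auto simp: colon_vars_def)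
    ultimately show "\<exists>i\<in>colon_vars a u. 0 < Poly_Mapping.lookup m i" by blast
  qed
  then show ?thesis by (auto simp: mem_var_ideal_iff mem_monomial_ideal_iff keys_mult_monomial)
qed

text \<open>Lexicographic upper sets are a class closed under removal of the least element
  \<open>u\<close>, which makes the induction possible. Restoring \<open>u\<close> is one cone with
  the Koszul resolution of its colon ideal; the shift of the cone turns \<open>i\<close> into
  \<open>i - 1\<close>.\<close>

lemma linear_resolution_upper_set:
  assumes "finite G" "G \<subseteq> capped d a" "\<And>v w. w \<in> G \<Longrightarrow> v \<in> capped d a \<Longrightarrow> lexgt v w \<Longrightarrow> v \<in> G"
  shows "\<exists>A. linear_resolution (ideal.span (monomial ` G) :: ('n, 'k::field) mpoly set) d
    (\<lambda>i. if i = 0 then 1 else \<Sum>u\<in>G. card (colon_vars a u) choose (i - 1)) A"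
  using assms
proof (induction "card G" arbitrary: G)
  case 0
  then have G: "G = {}" by simp
  have "(\<lambda>i. if i = 0 then 1 else \<Sum>u\<in>{}. card (colon_vars a u) choose (i - 1)) = (\<lambda>i. if i = 0 then 1 else 0)"
    by (rule ext) simp
  then show ?case unfolding G using linear_resolution_zero[of d] by simp
next
  case (Suc n)
  then have "G \<noteq> {}" by auto
  then obtain u where u: "u \<in> G" and min: "\<And>v. v \<in> G \<Longrightarrow> v \<noteq> u \<Longrightarrow> lexgt v u"
    using ex_lex_least[OF Suc.prems(1)] by blast
  define H where "H = G - {u}"
  have G: "G = insert u H" and uH: "u \<notin> H" and fin: "finite H" using u Suc.prems(1) by (auto simp: H_def)
  have up: "v \<in> H" if "w \<in> H" "v \<in> capped d a" "lexgt v w" for v w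
    using that Suc.prems(3)[of w v] min[of w] lexgt_irrefl lexgt_trans[of u w u] by (auto simp: H_def)
  have "n = card H" using Suc.hyps(2) G uH fin by simp
  then obtain A where A: "linear_resolution (ideal.span (monomial ` H) :: ('n, 'k) mpoly set) d
    (\<lambda>i. if i = 0 then 1 else \<Sum>u\<in>H. card (colon_vars a u) choose (i - 1)) A"
    using Suc.hyps(1)[OF _ fin] up Suc.prems(2) G by blast
  obtain C where C: "linear_resolution (ideal.span (var ` colon_vars a u) :: ('n, 'k) mpoly set) 1
      (\<lambda>i. card (colon_vars a u) choose i) C"
    using linear_resolution_var_ideal by blast
  have uc: "u \<in> capped d a" using u Suc.prems(2) by blast
  have col: "ideal.span (var ` colon_vars a u) = {f :: ('n, 'k) mpoly. f * monomial u \<in> ideal.span (monomial ` H)}"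
  proof (rule colon_upper_set[OF _ _ uc])
    show "H \<subseteq> capped d a" using Suc.prems(2) G by blast
    show "v \<in> insert u H" if "w \<in> insert u H" "v \<in> capped d a" "lexgt v w" for v w
      using Suc.prems(3)[of w v] that unfolding G by blast
    show "lexgt v u" if "v \<in> H" for v using min that by (simp add: H_def)
  qed
  have "homogeneous (int d) (monomial u :: ('n, 'k) mpoly)"
    using homogeneous_single[of u 1] uc by (simp add: capped_def)
  from linear_resolution_span_insert[OF A C col this]
  obtain E where E: "linear_resolution (ideal.span (insert (monomial u) (monomial ` H)) :: ('n, 'k) mpoly set) d
     (\<lambda>i. (if i = 0 then 1 else \<Sum>u\<in>H. card (colon_vars a u) choose (i - 1)) +
       (if i = 0 then 0 else card (colon_vars a u) choose (i - 1))) E" by blast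
  have "(\<lambda>i. (if i = 0 then 1 else \<Sum>u\<in>H. card (colon_vars a u) choose (i - 1)) +
       (if i = 0 then 0 else card (colon_vars a u) choose (i - 1)))
     = (\<lambda>i. if i = 0 then 1 else \<Sum>u\<in>G. card (colon_vars a u) choose (i - 1))"
    unfolding G using fin uH by auto
  moreover have "insert (monomial u) (monomial ` H) = (monomial ` G :: ('n, 'k) mpoly set)" unfolding G by simp
  ultimately show ?case using E by metis
qed

lemma linear_resolution_capped:
  "\<exists>A. linear_resolution (ideal.span (monomial ` capped d a) :: ('n, 'k::field) mpoly set) d
    (\<lambda>i. if i = 0 then 1 else \<Sum>u\<in>capped d a. card (colon_vars a u) choose (i - 1)) A"
  by (rule linear_resolution_upper_set) (simp_all add: finite_capped)

end

section \<open>Generators of the ideal and its powers\<close>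

lemma mult_mem_span_products:
  fixes a b :: "'a::comm_ring_1"
  assumes a: "a \<in> ideal.span A" and b: "b \<in> ideal.span B"
  shows "a * b \<in> ideal.span {x * y | x y. x \<in> A \<and> y \<in> B}" (is "_ \<in> ideal.span ?P")
proof -
  have "x * b \<in> ideal.span ?P" if x: "x \<in> A" for x
    using b
  proof (induction rule: ideal.span_induct_alt)
    case (step c y z)
    have "x * y \<in> ideal.span ?P" using x step(1) by (intro ideal.span_base) blast
    then have "c * (x * y) + x * z \<in> ideal.span ?P"
      by (rule ideal.span_add[OF ideal.span_scale step(2)])
    moreover have "x * (c * y + z) = c * (x * y) + x * z" by (simp only: distrib_left mult.left_commute)
    ultimately show ?case by (simp only:)
  qed (simp add: ideal.span_zero)
  note xb = this
  show ?thesis using a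
  proof (induction rule: ideal.span_induct_alt)
    case (step c x z)
    have "c * (x * b) + z * b \<in> ideal.span ?P"
      by (rule ideal.span_add[OF ideal.span_scale[OF xb[OF step(1)]] step(2)])
    moreover have "(c * x + z) * b = c * (x * b) + z * b" by (simp only: distrib_right mult.assoc)
    ultimately show ?case by (simp only:)
  qed (simp add: ideal.span_zero)
qed

lemma prod_mem_span_products:
  fixes f :: "'b \<Rightarrow> 'a::comm_ring_1"
  assumes "finite X" "\<And>x. x \<in> X \<Longrightarrow> f x \<in> ideal.span (G x)"
  shows "(\<Prod>x\<in>X. f x) \<in> ideal.span {\<Prod>x\<in>X. g x | g. \<forall>x\<in>X. g x \<in> G x}"
  using assms
proof (induction X rule: finite_induct)
  case (insert x X)
  let ?P = "\<lambda>X. {\<Prod>x\<in>X. g x | g. \<forall>x\<in>X. g x \<in> G x}"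
  have "f x * (\<Prod>x\<in>X. f x) \<in> ideal.span {a * b | a b. a \<in> G x \<and> b \<in> ?P X}"
    using insert by (intro mult_mem_span_products) auto
  moreover have "{a * b | a b. a \<in> G x \<and> b \<in> ?P X} \<subseteq> ?P (insert x X)"
  proof
    fix z assume "z \<in> {a * b | a b. a \<in> G x \<and> b \<in> ?P X}"
    then obtain a g where "a \<in> G x" "\<forall>x\<in>X. g x \<in> G x" and z: "z = a * (\<Prod>x\<in>X. g x)" by blast
    moreover have "(\<Prod>y\<in>X. g y) = (\<Prod>y\<in>X. (g(x := a)) y)"
      using insert.hyps by (intro prod.cong) auto
    then have "z = (\<Prod>y\<in>insert x X. (g(x := a)) y)"
      unfolding z using insert.hyps by simp
    ultimately show "z \<in> ?P (insert x X)" using insert.hyps by (intro CollectI exI[of _ "g(x := a)"]) auto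
  qed
  ultimately show ?case using ideal.span_mono insert.hyps by (metis (no_types, lifting) prod.insert subsetD)
qed (simp add: ideal.span_base)

lemma ideal_prod_span:
  assumes "finite X"
  shows "ideal_prod X (\<lambda>x. ideal.span (G x)) = ideal.span {\<Prod>x\<in>X. g x | g. \<forall>x\<in>X. g x \<in> G x}"
    (is "_ = ideal.span ?P")
proof (rule subset_antisym)
  show "ideal_prod X (\<lambda>x. ideal.span (G x)) \<subseteq> ideal.span ?P"
    unfolding ideal_prod_def
    by (rule ideal.span_minimal) (use prod_mem_span_products[OF assms] in \<open>auto simp: ideal.subspace_span\<close>)
  show "ideal.span ?P \<subseteq> ideal_prod X (\<lambda>x. ideal.span (G x))"
    unfolding ideal_prod_def by (intro ideal.span_mono) (blast intro: ideal.span_base)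
qed

section \<open>Monomials as products of chosen variables\<close>

lemma prod_monomial:
  "(\<Prod>x\<in>X. monomial (m x) :: ('n, 'k::comm_ring_1) mpoly) = monomial (\<Sum>x\<in>X. m x)"
  by (induction X rule: infinite_finite_induct) (simp_all add: mult_single single_one)

lemma lookup_sum_single:
  assumes "finite S"
  shows "Poly_Mapping.lookup (\<Sum>x\<in>S. Poly_Mapping.single (c x) (1::nat)) i = card {x\<in>S. c x = i}"
proof -
  have "(\<Sum>x\<in>S. (1::nat) when c x = i) = card {x\<in>S. c x = i}"
    using assms by (simp add: when_def sum.If_cases Int_def)
  then show ?thesis by (simp only: lookup_sum lookup_single)
qed

lemma mon_deg_sum_single:
  "mon_deg (\<Sum>x\<in>S. Poly_Mapping.single (c x :: 'n::finite) (1::nat)) = card S"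
proof (induction S rule: infinite_finite_induct)
  case (insert x F)
  then show ?case by (simp add: mon_deg_add mon_deg_single)
qed (simp_all add: mon_deg_def)

lemma ex_sum_single:
  fixes u :: "'n::finite \<Rightarrow>\<^sub>0 nat"
  assumes "finite S" "mon_deg u = card S"
  shows "\<exists>c. (\<Sum>x\<in>S. Poly_Mapping.single (c x) 1) = u"
  using assms
proof (induction S arbitrary: u rule: finite_induct)
  case empty
  then show ?case by (auto simp: mon_deg_def intro: poly_mapping_eqI)
next
  case (insert x S)
  then have "mon_deg u \<noteq> 0" by simp
  then obtain i where i: "Poly_Mapping.lookup u i > 0" unfolding mon_deg_def by (metis not_gr_zero sum.neutral)
  define v where "v = u - Poly_Mapping.single i 1"
  have u: "u = Poly_Mapping.single i 1 + v"
    using i by (intro poly_mapping_eqI) (auto simp: v_def lookup_add lookup_minus lookup_single when_def)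
  then have "mon_deg v = card S" using insert by (simp add: mon_deg_add mon_deg_single)
  then obtain c where "(\<Sum>x\<in>S. Poly_Mapping.single (c x) 1) = v" using insert by blast
  moreover have "(\<Sum>y\<in>S. Poly_Mapping.single ((c(x := i)) y) (1::nat)) = (\<Sum>y\<in>S. Poly_Mapping.single (c y) 1)"
    using insert.hyps by (intro sum.cong) auto
  ultimately have "(\<Sum>y\<in>insert x S. Poly_Mapping.single ((c(x := i)) y) 1) = u"
    using insert.hyps u by simp
  then show ?case by blast
qed

text \<open>Starting from any assignment with the prescribed fibre sizes, a forbidden value \<open>c x = g x\<close>
  can be swapped away, which lowers the number of forbidden values.\<close>

lemma ex_sum_single_avoiding:
  fixes u :: "'n::finite \<Rightarrow>\<^sub>0 nat" and g :: "'b \<Rightarrow> 'n"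
  assumes fin: "finite S" and deg: "mon_deg u = card S"
    and cap: "\<And>i. Poly_Mapping.lookup u i \<le> card {x\<in>S. g x \<noteq> i}"
  shows "\<exists>c. (\<forall>x\<in>S. c x \<noteq> g x) \<and> (\<Sum>x\<in>S. Poly_Mapping.single (c x) 1) = u"
proof -
  let ?sum = "\<lambda>c. \<Sum>x\<in>S. Poly_Mapping.single (c x) (1::nat)"
  let ?bad = "\<lambda>c. {x\<in>S. c x = g x}"
  obtain c0 where "?sum c0 = u" using ex_sum_single[OF fin deg] by blast
  then obtain c where c: "?sum c = u" and least: "\<And>c'. ?sum c' = u \<Longrightarrow> card (?bad c) \<le> card (?bad c')"
    using ex_has_least_nat[of "\<lambda>c. ?sum c = u" c0 "\<lambda>c. card (?bad c)"] by blast
  have "c x \<noteq> g x" if x: "x \<in> S" for x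
  proof
    assume cx: "c x = g x"
    \<comment> \<open>Otherwise \<open>c\<close> takes the value \<open>g x\<close> at
      \<open>x\<close> and at every \<open>y\<close> with \<open>g y \<noteq> g x\<close>, once more
      than the cap allows.\<close>
    have "\<exists>y\<in>S. g y \<noteq> g x \<and> c y \<noteq> g x"
    proof (rule ccontr)
      assume "\<not> ?thesis"
      then have "insert x {y\<in>S. g y \<noteq> g x} \<subseteq> {y\<in>S. c y = g x}" using cx x by auto
      then have "card (insert x {y\<in>S. g y \<noteq> g x}) \<le> card {y\<in>S. c y = g x}"
        using fin by (intro card_mono) auto
      moreover have "card {y\<in>S. c y = g x} = Poly_Mapping.lookup u (g x)"
        using lookup_sum_single[OF fin, of c] c by metis
      ultimately show False using cap[of "g x"] fin by simp
    qed
    then obtain y where y: "y \<in> S" "g y \<noteq> g x" "c y \<noteq> g x" by blast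
    then have xy: "x \<noteq> y" by auto
    \<comment> \<open>After the swap neither place is forbidden: \<open>c y\<close> differs from
      \<open>g x\<close>, and \<open>c x = g x\<close> differs from \<open>g y\<close>.\<close>
    define c' where "c' = c(x := c y, y := c x)"
    have S: "S = insert x (insert y (S - {x, y}))" using x y by auto
    have rest: "(\<Sum>z\<in>S - {x, y}. Poly_Mapping.single (c' z) (1::nat)) = (\<Sum>z\<in>S - {x, y}. Poly_Mapping.single (c z) 1)"
      by (intro sum.cong) (auto simp: c'_def)
    have dec: "?sum d = Poly_Mapping.single (d x) 1 + (Poly_Mapping.single (d y) 1 +
        (\<Sum>z\<in>S - {x, y}. Poly_Mapping.single (d z) 1))" for d :: "'b \<Rightarrow> 'n"
    proof -
      have "?sum d = (\<Sum>z\<in>insert x (insert y (S - {x, y})). Poly_Mapping.single (d z) 1)"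
        using S by (rule arg_cong)
      also have "\<dots> = Poly_Mapping.single (d x) 1 + (\<Sum>z\<in>insert y (S - {x, y}). Poly_Mapping.single (d z) 1)"
        using xy fin by (intro sum.insert) auto
      also have "(\<Sum>z\<in>insert y (S - {x, y}). Poly_Mapping.single (d z) (1::nat)) =
          Poly_Mapping.single (d y) 1 + (\<Sum>z\<in>S - {x, y}. Poly_Mapping.single (d z) 1)"
        using fin by (intro sum.insert) auto
      finally show ?thesis .
    qed
    have "c' x = c y" "c' y = c x" using xy by (auto simp: c'_def)
    then have "?sum c' = ?sum c" unfolding dec[of c] dec[of c'] rest by (simp only: add.left_commute)
    moreover have "?bad c' \<subset> ?bad c" using x y xy cx by (auto simp: c'_def)
    then have "card (?bad c') < card (?bad c)" using fin by (intro psubset_card_mono) auto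
    ultimately show False using least[of c'] c by simp
  qed
  then show ?thesis using c by blast
qed

text \<open>Sets of n - 1 variables are complements of points, so picking a variable from each
  factor is a map \<open>c\<close> with \<open>c i \<noteq> i\<close>. For n = 1 there is no such
  map, and the ideal is zero.\<close>

lemma codim_one_ideal_eq_span:
  "(codim_one_ideal :: ('n::finite, 'k::field) mpoly set) =
     ideal.span (monomial ` {\<Sum>i\<in>UNIV. Poly_Mapping.single (c i) 1 | c. \<forall>i. c i \<noteq> i})"
proof -
  let ?X = "{X :: 'n set. card X = CARD('n) - 1}"
  have inj: "inj (\<lambda>i :: 'n. - {i})" by (auto intro!: injI)
  have X: "?X = range (\<lambda>i. - {i})"
  proof (intro subset_antisym subsetI)
    fix X assume "X \<in> ?X"
    moreover have "card (UNIV - X) = CARD('n) - card X" by (rule card_Diff_subset) auto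
    moreover have "CARD('n) > 0" by simp
    ultimately have "card (- X) = 1" by (simp add: Compl_eq_Diff_UNIV del: zero_less_card_finite)
    then obtain i where "- X = {i}" by (auto simp: card_1_singleton_iff)
    then show "X \<in> range (\<lambda>i. - {i})" by (metis double_complement rangeI)
  qed (auto simp: card_Diff_subset Compl_eq_Diff_UNIV)
  have "{\<Prod>X\<in>?X. g X | g. \<forall>X\<in>?X. g X \<in> (var ` X :: ('n, 'k) mpoly set)} =
    monomial ` {\<Sum>i\<in>UNIV. Poly_Mapping.single (c i) 1 | c. \<forall>i. c i \<noteq> i}" (is "?L = ?R")
  proof (intro subset_antisym subsetI)
    fix p assume "p \<in> ?L"
    then obtain g where g: "\<And>X. X \<in> ?X \<Longrightarrow> g X \<in> (var ` X :: ('n, 'k) mpoly set)" and p: "p = (\<Prod>X\<in>?X. g X)" by blast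
    have "\<forall>i. \<exists>j. j \<noteq> i \<and> g (- {i}) = var j" using g unfolding X by auto
    then obtain c where c: "\<And>i. c i \<noteq> i" "\<And>i. g (- {i}) = var (c i)" by metis
    have "p = (\<Prod>i\<in>UNIV. g (- {i}))" unfolding p X using prod.reindex[OF inj, of g] by simp
    also have "\<dots> = monomial (\<Sum>i\<in>UNIV. Poly_Mapping.single (c i) 1)"
      unfolding c(2) var_def by (rule prod_monomial)
    finally show "p \<in> ?R" using c(1) by blast
  next
    fix p :: "('n, 'k) mpoly" assume "p \<in> ?R"
    then obtain c where c: "\<And>i. c i \<noteq> i" and p: "p = monomial (\<Sum>i\<in>UNIV. Poly_Mapping.single (c i) 1)" by blast
    \<comment> \<open>\<open>the_elem (- Y)\<close> recovers the one index that \<open>Y\<close>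
      omits.\<close>
    define g :: "'n set \<Rightarrow> ('n, 'k) mpoly" where "g Y = var (c (the_elem (- Y)))" for Y
    have "p = (\<Prod>i\<in>UNIV. g (- {i}))" unfolding p g_def var_def by (simp add: prod_monomial)
    also have "\<dots> = (\<Prod>X\<in>?X. g X)" unfolding X using prod.reindex[OF inj, of g] by simp
    finally show "p \<in> ?L" using c unfolding X by (intro CollectI exI[of _ g]) (auto simp: g_def)
  qed
  moreover have "(codim_one_ideal :: ('n, 'k) mpoly set) = ideal.span ?L"
    unfolding codim_one_ideal_def by (rule ideal_prod_span) simp
  ultimately show ?thesis by (simp only:)
qed

text \<open>A product of \<open>k\<close> generators fills the n k slots of \<open>?S\<close> with
  variables other than the first component of the slot. Variable \<open>i\<close> fits into (n - 1)
  k slots, whence the cap; that every capped monomial arises is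
  \<open>ex_sum_single_avoiding\<close>.\<close>

lemma codim_one_ideal_power_eq_span:
  "ideal_power (codim_one_ideal :: ('n::finite, 'k::field) mpoly set) k =
     ideal.span (monomial ` capped (CARD('n) * k) ((CARD('n) - 1) * k))"
proof -
  let ?E = "{\<Sum>i\<in>UNIV. Poly_Mapping.single (c i) (1::nat) | c. \<forall>i :: 'n. c i \<noteq> i}"
  let ?S = "(UNIV :: 'n set) \<times> {..<k}"
  have S: "(\<Sum>l<k. \<Sum>i\<in>UNIV. Poly_Mapping.single (c l i) 1) = (\<Sum>x\<in>?S. Poly_Mapping.single (c (snd x) (fst x)) (1::nat))"
    for c :: "nat \<Rightarrow> 'n \<Rightarrow> 'n"
    by (subst sum.swap) (simp add: sum.cartesian_product case_prod_beta)
  have cardS: "card ?S = CARD('n) * k" by simp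
  have cardS': "card {x\<in>?S. fst x \<noteq> i} = (CARD('n) - 1) * k" for i
  proof -
    have "{x\<in>?S. fst x \<noteq> i} = (UNIV - {i}) \<times> {..<k}" by auto
    then show ?thesis by (simp add: card_cartesian_product card_Diff_subset)
  qed
  have "{\<Prod>l<k. g l | g. \<forall>l\<in>{..<k}. g l \<in> (monomial ` ?E :: ('n, 'k) mpoly set)} =
    monomial ` capped (CARD('n) * k) ((CARD('n) - 1) * k)" (is "?L = ?R")
  proof (intro subset_antisym subsetI)
    fix p assume "p \<in> ?L"
    then obtain g where g: "\<And>l. l < k \<Longrightarrow> g l \<in> (monomial ` ?E :: ('n, 'k) mpoly set)" and p: "p = (\<Prod>l<k. g l)" by blast
    have "\<forall>l. \<exists>c. l < k \<longrightarrow> (\<forall>i. c i \<noteq> i) \<and> g l = monomial (\<Sum>i\<in>UNIV. Poly_Mapping.single (c i) 1)"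
      using g by blast
    then obtain c where c: "\<And>l i. l < k \<Longrightarrow> c l i \<noteq> i"
      "\<And>l. l < k \<Longrightarrow> g l = monomial (\<Sum>i\<in>UNIV. Poly_Mapping.single (c l i) 1)" by metis
    define u where "u = (\<Sum>x\<in>?S. Poly_Mapping.single (c (snd x) (fst x)) (1::nat))"
    have "p = (\<Prod>l<k. monomial (\<Sum>i\<in>UNIV. Poly_Mapping.single (c l i) 1))"
      unfolding p using c(2) by (intro prod.cong) auto
    then have pu: "p = monomial u" unfolding prod_monomial S u_def .
    have "Poly_Mapping.lookup u i \<le> (CARD('n) - 1) * k" for i
    proof -
      have "Poly_Mapping.lookup u i = card {x\<in>?S. c (snd x) (fst x) = i}"
        unfolding u_def by (rule lookup_sum_single) simp
      also have "\<dots> \<le> card {x\<in>?S. fst x \<noteq> i}" using c(1) by (intro card_mono) (auto, metis)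
      finally show ?thesis using cardS' by simp
    qed
    moreover have "mon_deg u = CARD('n) * k" unfolding u_def mon_deg_sum_single by (rule cardS)
    ultimately show "p \<in> ?R" unfolding pu capped_def by blast
  next
    fix p :: "('n, 'k) mpoly" assume "p \<in> ?R"
    then obtain u where u: "u \<in> capped (CARD('n) * k) ((CARD('n) - 1) * k)" and p: "p = monomial u" by blast
    have "\<exists>c. (\<forall>x\<in>?S. c x \<noteq> fst x) \<and> (\<Sum>x\<in>?S. Poly_Mapping.single (c x) 1) = u"
      using u cardS' cardS by (intro ex_sum_single_avoiding) (simp_all add: capped_def)
    then obtain c where c: "\<And>i l. l < k \<Longrightarrow> c (i, l) \<noteq> i" "(\<Sum>x\<in>?S. Poly_Mapping.single (c x) 1) = u" by fastforce
    have "u = (\<Sum>l<k. \<Sum>i\<in>UNIV. Poly_Mapping.single (c (i, l)) 1)"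
      unfolding S[of "\<lambda>l i. c (i, l)"] using c(2) by simp
    then have "p = (\<Prod>l<k. monomial (\<Sum>i\<in>UNIV. Poly_Mapping.single (c (i, l)) 1))"
      unfolding p prod_monomial by simp
    moreover have "monomial (\<Sum>i\<in>UNIV. Poly_Mapping.single (c (i, l)) 1) \<in> (monomial ` ?E :: ('n, 'k) mpoly set)"
      if "l < k" for l
      using c(1)[OF that] by (intro imageI CollectI exI[of _ "\<lambda>i. c (i, l)"]) simp
    ultimately show "p \<in> ?L" by blast
  qed
  moreover have "ideal_power (codim_one_ideal :: ('n, 'k) mpoly set) k = ideal.span ?L"
    unfolding ideal_power_def codim_one_ideal_eq_span by (rule ideal_prod_span) simp
  ultimately show ?thesis by (simp only:)
qed

section \<open>Counting the generators\<close>

definition mons :: "'n::finite set \<Rightarrow> nat \<Rightarrow> ('n \<Rightarrow>\<^sub>0 nat) set" where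
  "mons A d = {m. mon_deg m = d \<and> (\<forall>i. i \<notin> A \<longrightarrow> Poly_Mapping.lookup m i = 0)}"

lemma finite_mons: "finite (mons A d)"
  by (rule finite_subset[OF _ finite_mon_deg[of d]]) (auto simp: mons_def)

text \<open>Exponent vectors supported on \<open>A\<close> are multisets over \<open>A\<close>. The
  truncated subtraction is harmless for empty \<open>A\<close>: the value is 1 for
  \<open>d = 0\<close> and 0 otherwise.\<close>

lemma card_mons: "card (mons A d) = (card A + d - 1) choose d" for A :: "'n::finite set"
proof -
  let ?f = "\<lambda>M. Abs_poly_mapping (count M) :: 'n \<Rightarrow>\<^sub>0 nat"
  have l: "Poly_Mapping.lookup (?f M) = count M" for M by (rule lookup_Abs_poly_mapping) simp
  have deg: "mon_deg (?f M) = size M" for M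
    unfolding mon_deg_def l size_multiset_overloaded_eq
    by (rule sum.mono_neutral_right) (auto simp: not_in_iff)
  have "bij_betw ?f (multisets_of_size A d) (mons A d)"
    unfolding bij_betw_def
  proof (intro conjI subset_antisym subsetI)
    show "inj_on ?f (multisets_of_size A d)"
      by (rule inj_onI) (metis l multiset_eqI)
    fix m assume "m \<in> ?f ` multisets_of_size A d"
    then show "m \<in> mons A d" by (auto simp: mons_def deg l multisets_of_size_def not_in_iff[symmetric])
  next
    fix m assume m: "m \<in> mons A d"
    define M where "M = Abs_multiset (Poly_Mapping.lookup m)"
    have "count M = Poly_Mapping.lookup m" unfolding M_def by (rule count_Abs_multiset) simp
    then have fm: "?f M = m" by (metis l poly_mapping_eq_iff)
    have "size M = d" using deg[of M] m fm by (simp add: mons_def)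
    moreover have "set_mset M \<subseteq> A"
      using m \<open>count M = _\<close> by (auto simp: mons_def simp flip: count_greater_zero_iff)
    ultimately have "M \<in> multisets_of_size A d" by (simp add: multisets_of_size_def)
    then show "m \<in> ?f ` multisets_of_size A d" using fm by blast
  qed
  then have "card (mons A d) = card (multisets_of_size A d)" by (metis bij_betw_same_card)
  then show ?thesis by (simp add: card_multisets_of_size)
qed

lemma two_lookups_le_mon_deg:
  assumes "i \<noteq> j"
  shows "Poly_Mapping.lookup m i + Poly_Mapping.lookup m j \<le> mon_deg m"
proof -
  have "(\<Sum>x\<in>{i, j}. Poly_Mapping.lookup m x) \<le> mon_deg m"
    unfolding mon_deg_def by (rule sum_mono2) auto
  then show ?thesis using assms by simp
qed

lemma three_lookups_le_mon_deg:
  assumes "i \<noteq> j" "i \<noteq> p" "j \<noteq> p"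
  shows "Poly_Mapping.lookup m i + Poly_Mapping.lookup m j + Poly_Mapping.lookup m p \<le> mon_deg m"
proof -
  have "(\<Sum>x\<in>{i, j, p}. Poly_Mapping.lookup m x) \<le> mon_deg m"
    unfolding mon_deg_def by (rule sum_mono2) auto
  then show ?thesis using assms by simp
qed

lemma card_mons_above:
  assumes "i \<in> A"
  shows "card {m \<in> mons A (c + e). c \<le> Poly_Mapping.lookup m i} = card (mons A e)"
proof -
  have "bij_betw (\<lambda>m. m + Poly_Mapping.single i c) (mons A e) {m \<in> mons A (c + e). c \<le> Poly_Mapping.lookup m i}"
  proof (rule bij_betw_byWitness[where f' = "\<lambda>m. m - Poly_Mapping.single i c"])
    have e: "m - Poly_Mapping.single i c + Poly_Mapping.single i c = m"
      if "c \<le> Poly_Mapping.lookup m i" for m :: "'a \<Rightarrow>\<^sub>0 nat"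
      using that by (intro poly_mapping_eqI) (auto simp: lookup_add lookup_minus lookup_single when_def)
    then show "\<forall>m\<in>{m \<in> mons A (c + e). c \<le> Poly_Mapping.lookup m i}.
        m - Poly_Mapping.single i c + Poly_Mapping.single i c = m" by blast
    show "(\<lambda>m. m - Poly_Mapping.single i c) ` {m \<in> mons A (c + e). c \<le> Poly_Mapping.lookup m i} \<subseteq> mons A e"
    proof
      fix m' assume "m' \<in> (\<lambda>m. m - Poly_Mapping.single i c) ` {m \<in> mons A (c + e). c \<le> Poly_Mapping.lookup m i}"
      then obtain m where m: "m \<in> mons A (c + e)" "c \<le> Poly_Mapping.lookup m i"
        and m': "m' = m - Poly_Mapping.single i c" by blast
      have "mon_deg m' = e"
        using arg_cong[OF e[OF m(2)], of mon_deg] m unfolding m' by (simp add: mon_deg_add mon_deg_single mons_def)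
      then show "m' \<in> mons A e" using m by (simp add: mons_def m' lookup_minus)
    qed
    show "(\<lambda>m. m + Poly_Mapping.single i c) ` mons A e \<subseteq> {m \<in> mons A (c + e). c \<le> Poly_Mapping.lookup m i}"
    proof (intro image_subsetI CollectI conjI)
      fix m assume m: "m \<in> mons A e"
      then have "mon_deg (m + Poly_Mapping.single i c) = c + e" by (simp add: mons_def mon_deg_add mon_deg_single)
      moreover have "Poly_Mapping.lookup (m + Poly_Mapping.single i c) x = 0" if "x \<notin> A" for x
      proof -
        have "i \<noteq> x" using assms that by blast
        then show ?thesis using m that by (simp add: mons_def lookup_add lookup_single when_def)
      qed
      ultimately show "m + Poly_Mapping.single i c \<in> mons A (c + e)" by (simp add: mons_def)
      show "c \<le> Poly_Mapping.lookup (m + Poly_Mapping.single i c) i" by (simp add: lookup_add)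
    qed
  qed simp
  then show ?thesis by (rule bij_betw_same_card[symmetric])
qed

text \<open>Count the violations of the cap. Two exponents of at least \<open>Suc a\<close> would
  exceed \<open>2 * a\<close>, so a violation occurs at exactly one variable (with a single variable
  there is no second one), and dividing out \<open>Suc a\<close> there leaves an arbitrary monomial
  of degree \<open>e\<close>.\<close>

lemma card_capped:
  assumes "CARD('n::finite) = 1 \<or> Suc a + e \<le> 2 * a"
  shows "card (capped (Suc a + e) a :: ('n \<Rightarrow>\<^sub>0 nat) set) + CARD('n) * card (mons (UNIV :: 'n set) e)
    = card (mons (UNIV :: 'n set) (Suc a + e))"
proof -
  let ?M = "mons (UNIV :: 'n set) (Suc a + e)"
  let ?L = "\<lambda>i. {m \<in> ?M. Suc a \<le> Poly_Mapping.lookup m i}"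
  have un: "?M = capped (Suc a + e) a \<union> (\<Union>i. ?L i)"
    by (auto simp: capped_def mons_def not_less_eq_eq)
  have "card (\<Union>i. ?L i) = (\<Sum>i\<in>UNIV. card (?L i))"
  proof (rule card_UN_disjoint)
    show "\<forall>i\<in>UNIV. \<forall>j\<in>UNIV. i \<noteq> j \<longrightarrow> ?L i \<inter> ?L j = {}"
    proof (intro ballI impI)
      fix i j :: 'n assume ij: "i \<noteq> j"
      then have "CARD('n) \<noteq> 1" by (metis UNIV_I card_1_singletonE singletonD)
      then have "\<not> (m \<in> ?L i \<and> m \<in> ?L j)" for m
        using assms two_lookups_le_mon_deg[OF ij, of m] by (auto simp: mons_def)
      then show "?L i \<inter> ?L j = {}" by blast
    qed
  qed (auto simp: finite_mons)
  also have "\<dots> = CARD('n) * card (mons (UNIV :: 'n set) e)" 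
    using card_mons_above[of _ "UNIV :: 'n set" "Suc a" e] by simp
  finally have "card (\<Union>i. ?L i) = CARD('n) * card (mons (UNIV :: 'n set) e)" .
  moreover have "card ?M = card (capped (Suc a + e) a :: ('n \<Rightarrow>\<^sub>0 nat) set) + card (\<Union>i. ?L i)"
  proof (subst un, rule card_Un_disjoint)
    have "\<not> (m \<in> capped (Suc a + e) a \<and> m \<in> ?L i)" for m i
      by (auto simp: capped_def not_less_eq_eq[symmetric])
    then show "capped (Suc a + e) a \<inter> (\<Union>i. ?L i) = {}" by blast
  qed (simp_all add: finite_capped finite_mons)
  ultimately show ?thesis by simp
qed

section \<open>Monomials sorted by their number of colon variables\<close>

locale variable_enumeration = variable_order idx for idx :: "'n::finite \<Rightarrow> nat" +
  assumes range_idx: "range idx = {..<CARD('n)}"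
begin

definition initial :: "nat \<Rightarrow> 'n set" where
  "initial j = {i. idx i < j}"

lemma card_initial: "j \<le> CARD('n) \<Longrightarrow> card (initial j) = j"
proof -
  assume "j \<le> CARD('n)"
  have "idx ` initial j = {..<j}"
  proof (intro subset_antisym subsetI)
    fix x assume "x \<in> {..<j}"
    then have "x \<in> range idx" using \<open>j \<le> CARD('n)\<close> unfolding range_idx by simp
    then show "x \<in> idx ` initial j" using \<open>x \<in> {..<j}\<close> by (auto simp: initial_def)
  qed (auto simp: initial_def)
  moreover have "inj_on idx (initial j)" using inj_idx inj_on_subset by blast
  ultimately show ?thesis by (metis card_image card_lessThan)
qed

text \<open>A colon variable precedes some other variable, so the last one never occurs. This bounds
  the length of the resolution.\<close>

lemma card_colon_vars_le: "card (colon_vars a u) \<le> CARD('n) - 1"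
proof -
  have "colon_vars a u \<subseteq> initial (CARD('n) - 1)"
  proof
    fix i assume "i \<in> colon_vars a u"
    then obtain j where "idx i < idx j" by (auto simp: colon_vars_def)
    moreover have "idx j < CARD('n)" using range_idx by blast
    ultimately show "i \<in> initial (CARD('n) - 1)" by (simp add: initial_def)
  qed
  then have "card (colon_vars a u) \<le> card (initial (CARD('n) - 1))" by (intro card_mono) auto
  then show ?thesis by (simp add: card_initial)
qed

text \<open>Let the last variable in \<open>u\<close> have index p. The colon variables are those of
  index below p whose exponent is not \<open>a\<close>. Two exponents \<open>a\<close> and a third
  positive one would exceed \<open>2 * a\<close>, so at most one is lost, and the number is p or p -
  1. It is at most \<open>j\<close> iff p is at most \<open>j\<close>, or p is \<open>Suc j\<close>
  and one exponent before it equals \<open>a\<close>.\<close>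

lemma card_colon_vars_le_iff:
  assumes u: "u \<in> capped d a" and d: "d \<le> 2 * a" and j: "Suc j < CARD('n)" and w: "idx w = Suc j"
  shows "card (colon_vars a u) \<le> j \<longleftrightarrow> u \<in> mons (initial (Suc j)) d \<or>
    u \<in> mons (insert w (initial (Suc j))) d \<and> 0 < Poly_Mapping.lookup u w \<and>
      (\<exists>i\<in>initial (Suc j). Poly_Mapping.lookup u i = a)"
proof
  have deg: "mon_deg u = d" and le: "\<And>i. Poly_Mapping.lookup u i \<le> a" using u by (auto simp: capped_def)
  have "idx x = Suc j \<longleftrightarrow> x = w" for x using w inj_idx by (metis injD)
  then have ins: "insert w (initial (Suc j)) = initial (Suc (Suc j))"
    by (auto simp: initial_def less_Suc_eq)
  {
    assume c: "card (colon_vars a u) \<le> j"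
    have u2: "u \<in> mons (initial (Suc (Suc j))) d"
    proof (rule ccontr)
      assume "\<not> ?thesis"
      then obtain p where p: "p \<notin> initial (Suc (Suc j))" "0 < Poly_Mapping.lookup u p" by (auto simp: mons_def deg)
      let ?X = "{i \<in> initial (Suc (Suc j)). Poly_Mapping.lookup u i = a}"
      \<comment> \<open>Two exponents \<open>a\<close> together with the positive exponent at
        \<open>p\<close> would exceed the degree. Hence at least \<open>Suc j\<close> colon
        variables remain, a contradiction.\<close>
      have "card ?X \<le> Suc 0"
      proof (subst card_le_Suc0_iff_eq, simp, intro ballI, rule ccontr)
        fix x y assume xy: "x \<in> ?X" "y \<in> ?X" "x \<noteq> y"
        then have "x \<noteq> p" "y \<noteq> p" using p by auto
        then show False using three_lookups_le_mon_deg[of x y p u] xy p(2) deg d by simp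
      qed
      moreover have "initial (Suc (Suc j)) - ?X \<subseteq> colon_vars a u"
        using p le by (auto simp: colon_vars_def initial_def le_neq_implies_less intro!: exI[of _ p])
      then have "card (initial (Suc (Suc j)) - ?X) \<le> card (colon_vars a u)" by (intro card_mono) auto
      moreover have "card (initial (Suc (Suc j)) - ?X) = Suc (Suc j) - card ?X"
        using j by (subst card_Diff_subset) (auto simp: card_initial)
      ultimately show False using c by linarith
    qed
    show "u \<in> mons (initial (Suc j)) d \<or>
      u \<in> mons (insert w (initial (Suc j))) d \<and> 0 < Poly_Mapping.lookup u w \<and>
        (\<exists>i\<in>initial (Suc j). Poly_Mapping.lookup u i = a)"
    proof (cases "0 < Poly_Mapping.lookup u w")
      case True
      have "\<exists>i\<in>initial (Suc j). Poly_Mapping.lookup u i = a"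
      proof (rule ccontr)
        assume "\<not> ?thesis"
        then have "initial (Suc j) \<subseteq> colon_vars a u"
          using True le w by (auto simp: colon_vars_def initial_def le_neq_implies_less intro!: exI[of _ w])
        then have "card (initial (Suc j)) \<le> card (colon_vars a u)" by (intro card_mono) auto
        then show False using c j by (simp add: card_initial)
      qed
      then show ?thesis using True u2 ins by simp
    next
      case False
      then show ?thesis using u2 unfolding ins[symmetric] by (auto simp: mons_def) metis
    qed
  }
  {
    assume "u \<in> mons (initial (Suc j)) d \<or>
      u \<in> mons (insert w (initial (Suc j))) d \<and> 0 < Poly_Mapping.lookup u w \<and>
        (\<exists>i\<in>initial (Suc j). Poly_Mapping.lookup u i = a)"
    then show "card (colon_vars a u) \<le> j"
    proof (elim disjE conjE bexE)
      assume um: "u \<in> mons (initial (Suc j)) d"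
      have "colon_vars a u \<subseteq> initial j"
      proof
        fix x assume "x \<in> colon_vars a u"
        then obtain p where p: "idx x < idx p" "0 < Poly_Mapping.lookup u p" by (auto simp: colon_vars_def)
        then have "p \<in> initial (Suc j)" using um by (auto simp: mons_def)
        then show "x \<in> initial j" using p by (simp add: initial_def)
      qed
      then have "card (colon_vars a u) \<le> card (initial j)" by (intro card_mono) auto
      then show ?thesis using j by (simp add: card_initial)
    next
      fix i assume um: "u \<in> mons (insert w (initial (Suc j))) d" and i: "i \<in> initial (Suc j)" "Poly_Mapping.lookup u i = a"
      have "colon_vars a u \<subseteq> initial (Suc j) - {i}"
      proof
        fix x assume x: "x \<in> colon_vars a u"
        then obtain p where p: "idx x < idx p" "0 < Poly_Mapping.lookup u p" by (auto simp: colon_vars_def)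
        then have "p \<in> initial (Suc (Suc j))" using um unfolding ins by (auto simp: mons_def)
        then show "x \<in> initial (Suc j) - {i}" using p x i by (auto simp: initial_def colon_vars_def)
      qed
      then have "card (colon_vars a u) \<le> card (initial (Suc j) - {i})" by (intro card_mono) auto
      then show ?thesis using j i by (simp add: card_initial)
    qed
  }
qed

text \<open>The excess of an exponent over \<open>a\<close> is moved to the variable \<open>w\<close>.\<close>

lemma card_mons_excess:
  fixes i w :: 'n
  assumes i: "i \<in> A" and w: "w \<notin> A"
  shows "card {u \<in> mons (insert w A) d. 0 < Poly_Mapping.lookup u w \<and> Poly_Mapping.lookup u i = a} =
    card {m \<in> mons A d. a < Poly_Mapping.lookup m i}" (is "card ?S = card ?L")
proof -
  \<comment> \<open>\<open>f\<close> empties \<open>w\<close> into \<open>i\<close>;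
    \<open>g\<close> can undo this because the exponent at \<open>i\<close> was exactly
    \<open>a\<close>.\<close>
  define f where "f u = u + Poly_Mapping.single i (Poly_Mapping.lookup u w) - Poly_Mapping.single w (Poly_Mapping.lookup u w)"
    for u :: "'n \<Rightarrow>\<^sub>0 nat"
  define g where "g m = m + Poly_Mapping.single w (Poly_Mapping.lookup m i - a) - Poly_Mapping.single i (Poly_Mapping.lookup m i - a)"
    for m :: "'n \<Rightarrow>\<^sub>0 nat"
  have iw: "i \<noteq> w" using i w by auto
  have lf: "Poly_Mapping.lookup (f u) x = (if x = w then 0 else if x = i
      then Poly_Mapping.lookup u i + Poly_Mapping.lookup u w else Poly_Mapping.lookup u x)" for u x
    using iw by (auto simp: f_def lookup_add lookup_minus lookup_single when_def)
  have lg: "Poly_Mapping.lookup (g m) x = (if x = w then Poly_Mapping.lookup m w + (Poly_Mapping.lookup m i - a)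
      else if x = i then Poly_Mapping.lookup m i - (Poly_Mapping.lookup m i - a) else Poly_Mapping.lookup m x)" for m x
    using iw by (auto simp: g_def lookup_add lookup_minus lookup_single when_def)
  have "f u + Poly_Mapping.single w (Poly_Mapping.lookup u w) = u + Poly_Mapping.single i (Poly_Mapping.lookup u w)" for u
    using iw by (intro poly_mapping_eqI) (auto simp: lf lookup_add lookup_single when_def)
  from arg_cong[OF this, of mon_deg] have df: "mon_deg (f u) = mon_deg u" for u
    by (simp add: mon_deg_add mon_deg_single)
  have "g m + Poly_Mapping.single i (Poly_Mapping.lookup m i - a) = m + Poly_Mapping.single w (Poly_Mapping.lookup m i - a)" for m
    using iw by (intro poly_mapping_eqI) (auto simp: lg lookup_add lookup_single when_def)
  from arg_cong[OF this, of mon_deg] have dg: "mon_deg (g m) = mon_deg m" for m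
    by (simp add: mon_deg_add mon_deg_single)
  have "bij_betw f ?S ?L"
  proof (rule bij_betw_byWitness[where f' = g])
    show "\<forall>u\<in>?S. g (f u) = u"
      using iw by (auto intro!: poly_mapping_eqI simp: lg lf)
    show "\<forall>m\<in>?L. f (g m) = m"
      using iw w by (auto intro!: poly_mapping_eqI simp: lg lf mons_def)
    show "f ` ?S \<subseteq> ?L" using iw i w by (auto simp: mons_def df lf)
    show "g ` ?L \<subseteq> ?S" using iw i w by (auto simp: mons_def dg lg)
  qed
  then show ?thesis by (rule bij_betw_same_card)
qed

text \<open>The pieces \<open>?C\<close> stay in place and each \<open>?S i\<close> is matched with
  \<open>?L i\<close>, so that together they fill \<open>mons V d\<close>. Both families are
  disjoint by \<open>d \<le> 2 * a\<close>: two exponents \<open>a\<close> besides a positive one at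
  \<open>w\<close>, or two exponents above \<open>a\<close>, exceed the degree.\<close>

lemma card_few_colon_vars:
  assumes d: "d \<le> 2 * a" and j: "Suc j < CARD('n)"
  shows "card {u \<in> capped d a. card (colon_vars a u) \<le> j} = (d + j) choose j"
proof -
  obtain w where w: "idx w = Suc j" using j range_idx by (metis imageE lessThan_iff)
  define V where "V = initial (Suc j)"
  have wV: "w \<notin> V" using w by (simp add: V_def initial_def)
  let ?C = "capped d a \<inter> mons V d"
  let ?S = "\<lambda>i. {u \<in> mons (insert w V) d. 0 < Poly_Mapping.lookup u w \<and> Poly_Mapping.lookup u i = a}"
  let ?L = "\<lambda>i. {m \<in> mons V d. a < Poly_Mapping.lookup m i}"
  \<comment> \<open>The exponent \<open>a\<close> at \<open>i\<close> leaves at most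
    \<open>d - a\<close>, hence at most \<open>a\<close>, for any other variable.\<close>
  have capS: "u \<in> capped d a" if "u \<in> ?S i" for u i
  proof -
    have "Poly_Mapping.lookup u p \<le> a" for p
      using that two_lookups_le_mon_deg[of i p u] d by (cases "p = i") (auto simp: mons_def)
    then show ?thesis using that by (simp add: mons_def capped_def)
  qed
  have "{u \<in> capped d a. card (colon_vars a u) \<le> j} = ?C \<union> (\<Union>i\<in>V. ?S i)"
  proof (intro subset_antisym subsetI)
    fix u assume u: "u \<in> {u \<in> capped d a. card (colon_vars a u) \<le> j}"
    then show "u \<in> ?C \<union> (\<Union>i\<in>V. ?S i)" 
      using card_colon_vars_le_iff[of u d a j w] d j w unfolding V_def by auto
  next
    fix u assume u: "u \<in> ?C \<union> (\<Union>i\<in>V. ?S i)"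
    then have "u \<in> capped d a" using capS by blast
    then show "u \<in> {u \<in> capped d a. card (colon_vars a u) \<le> j}"
      using u card_colon_vars_le_iff[of u d a j w] d j w unfolding V_def by auto
  qed
  also have "card \<dots> = card ?C + card (\<Union>i\<in>V. ?S i)"
  proof (rule card_Un_disjoint)
    have "\<not> (u \<in> mons V d \<and> u \<in> ?S i)" for u i using wV by (auto simp: mons_def)
    then show "?C \<inter> (\<Union>i\<in>V. ?S i) = {}" by blast
  qed (simp_all add: finite_capped finite_mons)
  also have "card (\<Union>i\<in>V. ?S i) = (\<Sum>i\<in>V. card (?S i))"
  proof (rule card_UN_disjoint)
    show "\<forall>i\<in>V. \<forall>i'\<in>V. i \<noteq> i' \<longrightarrow> ?S i \<inter> ?S i' = {}"
    proof (intro ballI impI, rule ccontr)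
      fix i i' assume ii: "i \<in> V" "i' \<in> V" "i \<noteq> i'" "?S i \<inter> ?S i' \<noteq> {}"
      then obtain u where u: "u \<in> ?S i" "u \<in> ?S i'" by blast
      have "i \<noteq> w" "i' \<noteq> w" using ii wV by auto
      then show False using three_lookups_le_mon_deg[of i i' w u] ii u d by (simp add: mons_def)
    qed
  qed (auto simp: finite_mons)
  also have "\<dots> = (\<Sum>i\<in>V. card (?L i))"
    using card_mons_excess[OF _ wV] by simp
  also have "\<dots> = card (\<Union>i\<in>V. ?L i)"
  proof (rule card_UN_disjoint[symmetric])
    show "\<forall>i\<in>V. \<forall>i'\<in>V. i \<noteq> i' \<longrightarrow> ?L i \<inter> ?L i' = {}"
    proof (intro ballI impI, rule ccontr)
      fix i i' assume ii: "i \<in> V" "i' \<in> V" "i \<noteq> i'" "?L i \<inter> ?L i' \<noteq> {}"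
      then obtain u where u: "u \<in> ?L i" "u \<in> ?L i'" by blast
      then show False using two_lookups_le_mon_deg[of i i' u] ii d by (simp add: mons_def)
    qed
  qed (auto simp: finite_mons)
  also have "card ?C + card (\<Union>i\<in>V. ?L i) = card (?C \<union> (\<Union>i\<in>V. ?L i))"
  proof (rule card_Un_disjoint[symmetric])
    have "\<not> (m \<in> capped d a \<and> m \<in> ?L i)" for m i by (auto simp: capped_def not_less[symmetric])
    then show "?C \<inter> (\<Union>i\<in>V. ?L i) = {}" by blast
  qed (simp_all add: finite_capped finite_mons)
  also have "?C \<union> (\<Union>i\<in>V. ?L i) = mons V d"
    by (auto simp: capped_def mons_def) (metis not_le not_less_zero)
  also have "card (mons V d) = (d + j) choose d"
    using j by (simp add: card_mons V_def card_initial add.commute)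
  also have "\<dots> = (d + j) choose j" using binomial_symmetric[of d "d + j"] by simp
  finally show ?thesis .
qed

end

lemma ex_variable_enumeration: "\<exists>idx :: 'n::finite \<Rightarrow> nat. variable_enumeration idx"
proof -
  obtain idx :: "'n \<Rightarrow> nat" where "bij_betw idx UNIV {0..<CARD('n)}"
    using ex_bij_betw_finite_nat[OF finite] by blast
  then have "variable_enumeration idx"
    by unfold_locales (auto simp: bij_betw_def lessThan_atLeast0)
  then show ?thesis by blast
qed

section \<open>From cumulative counts to sums of binomials\<close>

lemma choose_Suc_eq_sum: "t choose Suc i = (\<Sum>j<t. j choose i)"
  by (induction t) auto

text \<open>Expand each binomial by the hockey-stick identity over \<open>j < t u\<close> and
  exchange the sums; the weight of \<open>j choose i\<close> is then the number of \<open>u\<close>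
  with \<open>j < t u\<close>. It is written as a difference in \<open>int\<close> because the
  cumulative counts are the known ones.\<close>

lemma sum_choose_Suc:
  assumes fin: "finite B" and le: "\<And>u. u \<in> B \<Longrightarrow> t u \<le> N"
  shows "int (\<Sum>u\<in>B. t u choose Suc i) =
    (\<Sum>j<N. int (j choose i) * (int (card B) - int (card {u\<in>B. t u \<le> j})))"
proof -
  have "(\<Sum>u\<in>B. t u choose Suc i) = (\<Sum>u\<in>B. \<Sum>j<N. if j < t u then j choose i else 0)"
  proof (rule sum.cong[OF refl])
    fix u assume "u \<in> B"
    then have "t u \<le> N" by (rule le)
    then show "t u choose Suc i = (\<Sum>j<N. if j < t u then j choose i else 0)"
      unfolding choose_Suc_eq_sum by (intro sum.mono_neutral_cong_left) auto
  qed
  also have "\<dots> = (\<Sum>j<N. \<Sum>u\<in>B. if j < t u then j choose i else 0)" by (rule sum.swap)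
  also have "\<dots> = (\<Sum>j<N. (j choose i) * card {u\<in>B. j < t u})"
    using fin by (intro sum.cong refl) (simp add: sum.If_cases Int_def mult.commute)
  also have "int \<dots> = (\<Sum>j<N. int (j choose i) * (int (card B) - int (card {u\<in>B. t u \<le> j})))"
    unfolding of_nat_sum of_nat_mult
  proof (intro sum.cong refl arg_cong2[of _ _ _ _ "(*)"])
    fix j
    have "{u\<in>B. j < t u} = B - {u\<in>B. t u \<le> j}" by auto
    then have "card {u\<in>B. j < t u} = card B - card {u\<in>B. t u \<le> j}"
      using fin by (simp add: card_Diff_subset)
    moreover have "card {u\<in>B. t u \<le> j} \<le> card B" using fin by (intro card_mono) auto
    ultimately show "int (card {u\<in>B. j < t u}) = int (card B) - int (card {u\<in>B. t u \<le> j})" by simp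
  qed
  finally show ?thesis .
qed

theorem corollary2p7:
  fixes I :: "('n::finite, 'k::field) mpoly set" and n k :: nat and \<beta> :: "nat \<Rightarrow> nat"
  assumes "n = CARD('n)"
    and "I = codim_one_ideal"
    and "k \<ge> 1"
    and "\<beta> = betti (ideal_power I k)"
  shows "int (\<beta> 1) =
           int ((n * (k + 1) - 1) choose (n - 1)) - int n * int ((n + k - 2) choose (n - 1)) \<and>
         vec (n - 1) (\<lambda>i. int (\<beta> (i + 2))) =
           mat (n - 1) (n - 1) (\<lambda>(i, j). int (j choose i)) *\<^sub>v
           vec (n - 1) (\<lambda>i. int (\<beta> 1) - int ((n * k + i) choose i))"
proof -
  obtain idx :: "'n \<Rightarrow> nat" where idx: "variable_enumeration idx" using ex_variable_enumeration by blast
  interpret variable_enumeration idx by (rule idx)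
  define a where "a = (n - 1) * k"
  define B where "B = (capped (n * k) a :: ('n \<Rightarrow>\<^sub>0 nat) set)"
  define b where "b i = (if i = 0 then 1 else \<Sum>u\<in>B. card (colon_vars a u) choose (i - 1))" for i
  have n: "n \<ge> 1" using assms(1) by (simp add: Suc_leI)
  have le: "card (colon_vars a u) \<le> n - 1" for u using card_colon_vars_le assms(1) by simp
  \<comment> \<open>When one exponent passes the cap, degree \<open>k - 1\<close> is left to
    distribute; this is the origin of \<open>n + k - 2\<close> in the first formula.\<close>
  have nk: "n * k = Suc a + (k - 1)"
    using n assms(3) by (cases n) (auto simp: a_def)
  have J: "ideal_power I k = ideal.span (monomial ` B)"
    unfolding assms(2) B_def a_def assms(1) by (rule codim_one_ideal_power_eq_span)
  obtain A where "linear_resolution (ideal_power I k) (n * k) b A"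
    using linear_resolution_capped[of "n * k" a] unfolding J B_def b_def by blast
  \<comment> \<open>A Koszul resolution on at most n - 1 variables, shifted by one position, ends at
    n.\<close>
  moreover have "b i = 0" if "i > CARD('n)" for i
  proof -
    have "card (colon_vars a u) choose (i - 1) = 0" for u
      using le[of u] n that assms(1) by (intro binomial_eq_0) linarith
    then show ?thesis using that by (simp add: b_def)
  qed
  moreover have "n * k > 0" using n assms(3) by simp
  ultimately have \<beta>: "\<beta> i = b i" for i
    unfolding assms(4) by (intro betti_eqI[OF minimal_graded_resolution_if_linear])
  have \<beta>1: "\<beta> 1 = card B" by (simp add: \<beta> b_def)
  have cardB: "int (\<beta> 1) = int ((n * (k + 1) - 1) choose (n - 1)) - int n * int ((n + k - 2) choose (n - 1))"
  proof -
    have "CARD('n) = 1 \<or> Suc a + (k - 1) \<le> 2 * a"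
    proof (cases "n = 1")
      case False
      with n have "n = Suc (Suc (n - 2))" by linarith
      then obtain m where "n = Suc (Suc m)" by blast
      then show ?thesis using assms(3) by (simp add: a_def)
    qed (use assms(1) in simp)
    from card_capped[OF this] have "card B + n * ((n + (k - 1) - 1) choose (k - 1)) = (n + n * k - 1) choose (n * k)"
      unfolding nk[symmetric] card_mons assms(1)[symmetric] B_def .
    moreover have "(n + (k - 1) - 1) choose (k - 1) = (n + k - 2) choose (n - 1)"
      using binomial_symmetric[of "k - 1" "n + k - 2"] n assms(3) by (simp add: algebra_simps numeral_2_eq_2)
    moreover have "(n + n * k - 1) choose (n * k) = (n * (k + 1) - 1) choose (n - 1)"
      using binomial_symmetric[of "n * k" "n + n * k - 1"] n by (simp add: algebra_simps)
    ultimately have "card B + n * ((n + k - 2) choose (n - 1)) = (n * (k + 1) - 1) choose (n - 1)" by simp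
    then have "int (card B) + int n * int ((n + k - 2) choose (n - 1)) = int ((n * (k + 1) - 1) choose (n - 1))"
      by (metis of_nat_add of_nat_mult)
    then show ?thesis unfolding \<beta>1 by linarith
  qed
  have "vec (n - 1) (\<lambda>i. int (\<beta> (i + 2))) =
           mat (n - 1) (n - 1) (\<lambda>(i, j). int (j choose i)) *\<^sub>v
           vec (n - 1) (\<lambda>i. int (\<beta> 1) - int ((n * k + i) choose i))" (is "_ = ?M *\<^sub>v ?v")
  proof (rule eq_vecI)
    fix i assume "i < dim_vec (?M *\<^sub>v ?v)"
    then have i: "i < n - 1" by simp
    \<comment> \<open>An index below \<open>n - 1\<close> exists only for n at least 2, which is
      exactly when the cap reaches half the degree.\<close>
    have d: "n * k \<le> 2 * a"
    proof -
      have "n = Suc (Suc (n - 2))" using i by linarith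
      then obtain m where "n = Suc (Suc m)" by blast
      then show ?thesis by (simp add: a_def)
    qed
    \<comment> \<open>Row \<open>i\<close> stands for position \<open>i + 2\<close>, and
      \<open>b\<close> lowers its index by one, hence \<open>Suc i\<close>.\<close>
    have "int (\<beta> (i + 2)) = int (\<Sum>u\<in>B. card (colon_vars a u) choose Suc i)" by (simp add: \<beta> b_def)
    also have "\<dots> = (\<Sum>j<n - 1. int (j choose i) * (int (card B) - int (card {u\<in>B. card (colon_vars a u) \<le> j})))"
      by (rule sum_choose_Suc) (use le in \<open>auto simp: B_def finite_capped\<close>)
    also have "\<dots> = (\<Sum>j<n - 1. int (j choose i) * (int (\<beta> 1) - int ((n * k + j) choose j)))"
      unfolding B_def \<beta>1 using card_few_colon_vars[OF d] assms(1) by (intro sum.cong refl) simp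
    also have "\<dots> = (?M *\<^sub>v ?v) $ i"
      using i by (simp add: scalar_prod_def lessThan_atLeast0)
    finally show "vec (n - 1) (\<lambda>i. int (\<beta> (i + 2))) $ i = (?M *\<^sub>v ?v) $ i" using i by simp
  qed simp
  then show ?thesis using cardB by blast
qed

end
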